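(* Let $\delta\in(0,1)$, let $X\subset\mathbb{R}_+$ be a Borel set with $0\in X$ and $\bar x=\sup X<\infty$, and let $0<x_0\le\bar x$. For $x\in[0,1]$ define $$q^*(x)=\frac{2(1-\delta)}{4-2\delta+x-\sqrt{x(x+8)}},\qquad \rho(x)=\frac12+\frac18\left(x+\sqrt{x(x+8)}\right).$$ Then there exists a constant $L\in(0,1)$ such that $R^*(x_0,\mathcal F_X)\ge\rho(x_0/\bar x)>1/2$ whenever $x_0/\bar x\ge L$. Moreover, if $x_0/\bar x\ge 1/6$, then the stationary decision rule $p^*$ given by $p^*(y)=q^*(y/\bar x)$ for each best-so-far alternative $y\in[x_0,\bar x]$ satisfies: (a) $p^*$ attains the performance ratio $\rho(x_0/\bar x)>1/2$, i.e. $R_{p^*}(x_0,\mathcal F_X)=\rho(x_0/\bar x)$; (b) if $1/6\le x_0/\bar x\le\delta^2/(2-\delta)$, then $p^*$ is dynamically robust for $(x_0,\mathcal F_X)$.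
   Context: Sequential search model. Fix a discount factor $\delta\in(0,1)$, a Borel set $X\subset\mathbb{R}_+$ with $0\in X$, and an outside option $x_0>0$. Let $\mathcal F_X$ be the set of all Borel probability distributions on $X$ with finite mean ("environments"); a set of feasible environments is any $\mathcal F\subset\mathcal F_X$. A history is $h_t=(x_0,x_1,\dots,x_t)$, $t\ge 0$, $x_i\in X$; its best-so-far alternative is $y_t=\max\{x_0,\dots,x_t\}$; $\mathcal H(x_0)$ is the set of all such histories. A decision rule $p$ assigns to each history $h$ a stopping probability $p(h)\in[0,1]$; it is stationary if $p(h)$ depends on $h$ only through its best-so-far alternative, written $p(y)$. Given an environment $F$ and a history $h_t$, the future alternatives are i.i.d. with law $F$; at each round $s\ge t$ the individual stops with probability $p(h_s)$ (otherwise observes the next alternative), and stopping at round $s$ yields $\delta^{s-t}y_s$ (never stopping yields $0$). $U_p(F,h_t)$ is the expected payoff, and $V(F,h)=\sup_pU_p(F,h)$. A prior is a finitely supported probability distribution $\mu$ on $\mathcal F$; $\Delta(\mathcal F)$ is the set of priors. An environment or prior is consistent with $h_t$ if $x_1,\dots,x_t$ occurs with positive probability under it; $\mathcal F(h)$, $\Delta(\mathcal F(h))$ denote the consistent ones. For consistent $\mu$, $U_p(\mu,h)=\sum_F\mu(F\mid h)U_p(F,h)$ with $\mu(\cdot\mid h)$ the Bayesian posterior, and $V(\mu,h)=\sup_pU_p(\mu,h)$. The performance ratio is $R_p(x_0,\mathcal F)=\inf_{h\in\mathcal H(x_0)}\inf_{\mu\in\Delta(\mathcal F(h))}U_p(\mu,h)/V(\mu,h)$,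 $R^*(x_0,\mathcal F)=\sup_pR_p(x_0,\mathcal F)$ over all decision rules, and $p$ is dynamically robust if $R_p(x_0,\mathcal F)=R^*(x_0,\mathcal F)$. *)

theory Defs
  imports "HOL-Probability.Probability"
begin

text \<open>Histories are lists [x0, x1, ..., xt] (head = outside option).\<close>

definition best :: "real list \<Rightarrow> real" where
  "best h = Max (set h)"

definition histories :: "real set \<Rightarrow> real \<Rightarrow> real list set" where
  "histories X x0 = {h. h \<noteq> [] \<and> hd h = x0 \<and> set (tl h) \<subseteq> X}"

definition environments :: "real set \<Rightarrow> real measure set" where
  "environments X = {F. prob_space F \<and> sets F = sets borel \<and> emeasure F X = 1
                        \<and> integrable F (\<lambda>x. x)}"

definition decision_rule :: "(real list \<Rightarrow> real) \<Rightarrow> bool" where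
  "decision_rule p \<longleftrightarrow> (\<forall>h. 0 \<le> p h \<and> p h \<le> 1)"

definition stationary :: "(real list \<Rightarrow> real) \<Rightarrow> bool" where
  "stationary p \<longleftrightarrow> (\<forall>h h'. h \<noteq> [] \<and> h' \<noteq> [] \<and> best h = best h' \<longrightarrow> p h = p h')"

text \<open>Expected payoff U_p(F,h): sum over k of stopping exactly k rounds after h,
  with the k future alternatives i.i.d. with law F.\<close>
definition payoff_env :: "real \<Rightarrow> (real list \<Rightarrow> real) \<Rightarrow> real measure \<Rightarrow> real list \<Rightarrow> real" where
  "payoff_env \<delta> p F h = enn2real (\<Sum>k. \<integral>\<^sup>+ \<omega>.
      ennreal ((\<Prod>j<k. (1 - p (h @ map \<omega> [0..<j]))) * p (h @ map \<omega> [0..<k])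
               * \<delta> ^ k * best (h @ map \<omega> [0..<k]))
      \<partial>(PiM {..<k} (\<lambda>_. F)))"

definition likelihood :: "real measure \<Rightarrow> real list \<Rightarrow> real" where
  "likelihood F h = prod_list (map (\<lambda>x. measure F {x}) (tl h))"

definition consistent_env :: "real measure \<Rightarrow> real list \<Rightarrow> bool" where
  "consistent_env F h \<longleftrightarrow> likelihood F h > 0"

definition priors :: "real measure set \<Rightarrow> real measure pmf set" where
  "priors Fs = {\<mu>. finite (set_pmf \<mu>) \<and> set_pmf \<mu> \<subseteq> Fs}"

definition posterior :: "real measure pmf \<Rightarrow> real list \<Rightarrow> real measure \<Rightarrow> real" where
  "posterior \<mu> h F = pmf \<mu> F * likelihood F h
      / (\<Sum>G\<in>set_pmf \<mu>. pmf \<mu> G * likelihood G h)"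

definition payoff_prior :: "real \<Rightarrow> (real list \<Rightarrow> real) \<Rightarrow> real measure pmf \<Rightarrow> real list \<Rightarrow> real" where
  "payoff_prior \<delta> p \<mu> h = (\<Sum>F\<in>set_pmf \<mu>. posterior \<mu> h F * payoff_env \<delta> p F h)"

definition value_prior :: "real \<Rightarrow> real measure pmf \<Rightarrow> real list \<Rightarrow> real" where
  "value_prior \<delta> \<mu> h = (SUP p\<in>{p. decision_rule p}. payoff_prior \<delta> p \<mu> h)"

definition perf_ratio :: "real \<Rightarrow> real set \<Rightarrow> real measure set \<Rightarrow> (real list \<Rightarrow> real) \<Rightarrow> real \<Rightarrow> real" where
  "perf_ratio \<delta> X Fs p x0 =
     (INF hm\<in>{(h, \<mu>). h \<in> histories X x0 \<and> \<mu> \<in> priors {F \<in> Fs. consistent_env F h}}.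
        payoff_prior \<delta> p (snd hm) (fst hm) / value_prior \<delta> (snd hm) (fst hm))"

definition R_star :: "real \<Rightarrow> real set \<Rightarrow> real measure set \<Rightarrow> real \<Rightarrow> real" where
  "R_star \<delta> X Fs x0 = (SUP p\<in>{p. decision_rule p}. perf_ratio \<delta> X Fs p x0)"

definition dynamically_robust :: "real \<Rightarrow> real set \<Rightarrow> real measure set \<Rightarrow> (real list \<Rightarrow> real) \<Rightarrow> real \<Rightarrow> bool" where
  "dynamically_robust \<delta> X Fs p x0 \<longleftrightarrow> perf_ratio \<delta> X Fs p x0 = R_star \<delta> X Fs x0"

definition qstar :: "real \<Rightarrow> real \<Rightarrow> real" where
  "qstar \<delta> x = 2 * (1 - \<delta>) / (4 - 2 * \<delta> + x - sqrt (x * (x + 8)))"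

definition rho :: "real \<Rightarrow> real" where
  "rho x = 1/2 + (x + sqrt (x * (x + 8))) / 8"

text \<open>p*(y) = q*(y / xbar); the argument is clamped to [0,1], which is irrelevant on
  histories in H(x0) (there y is in [x0, xbar]).\<close>
definition pstar :: "real \<Rightarrow> real \<Rightarrow> real list \<Rightarrow> real" where
  "pstar \<delta> xbar h = qstar \<delta> (max 0 (min 1 (best h / xbar)))"

end

theory Submission
  imports Defs
begin

text \<open>
  An environment \<open>F\<close> enters only through its reservation value \<open>c = \<delta> * E (max c x)\<close>: the optimal
  payoff at best alternative \<open>y\<close> is at most \<open>max y c\<close>. Normalise \<open>xbar = 1\<close>. The function \<open>rho\<close> solves
  \<open>(2 * rho y - 1)\<^sup>2 = y * rho y\<close>, and \<open>qstar y\<close> is the stopping probability whose payoff is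
  \<open>rho y * y\<close> if only zeros follow. For \<open>y \<ge> 1/6\<close> the function \<open>rho y * max y c\<close> is a subsolution of the
  payoff recursion of \<open>pstar\<close>, hence a lower bound for its payoff, which gives the ratio \<open>rho\<close>; the
  point mass at 0 shows that it is not better.

  For the upper bound on an arbitrary rule, consider the histories \<open>x0, 0, ..., 0\<close>, the point mass
  at 0 and environments on \<open>{0, x}\<close> with \<open>x\<close> close to \<open>xbar\<close>. The former punishes continuing and the
  latter stopping; a rule that stops with time-dependent probabilities along the zeros cannot do
  better against both than one that stops with a constant probability, and the worst such two-point
  environment pushes the ratio down to \<open>rho\<close>.
\<close>

subsection \<open>The functions rho and qstar\<close>

lemma rho_pos: "0 \<le> x \<Longrightarrow> 1/2 \<le> rho x" "0 < x \<Longrightarrow> 1/2 < rho x"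
  by (auto simp: rho_def add_pos_nonneg)

text \<open>Of the two roots \<open>r\<close> of \<open>(2 * r - 1)\<^sup>2 = x * r\<close>,
  \<open>rho x\<close> is the larger one. The estimates below mostly use this equation in place of
  the square root.\<close>

lemma rho_quadratic:
  assumes "0 \<le> x"
  shows "rho x * x = (2 * rho x - 1)\<^sup>2"
proof -
  define s where "s = sqrt (x * (x + 8))"
  have s: "s\<^sup>2 = x * (x + 8)"
    using assms by (simp add: s_def)
  have "64 * (rho x * x - (2 * rho x - 1)\<^sup>2) = 4 * (x * (x + 8) - s\<^sup>2)"
    unfolding rho_def s_def[symmetric] by (simp add: field_simps power2_eq_square)
  then show ?thesis using s by simp
qed

lemma rho_mono:
  assumes "0 \<le> x" "x \<le> y"
  shows "rho x \<le> rho y"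
proof -
  have "x * (x + 8) \<le> y * (y + 8)"
    using assms by (intro mult_mono) auto
  then show ?thesis using assms unfolding rho_def by (simp add: add_mono divide_right_mono)
qed

lemma rho_1: "rho 1 = 1"
  using real_sqrt_abs[of 3] by (simp add: rho_def)

lemma rho_le_1: "0 \<le> x \<Longrightarrow> x \<le> 1 \<Longrightarrow> rho x \<le> 1"
  using rho_mono[of x 1] rho_1 by simp

lemma rho_less_1:
  assumes "0 \<le> x" "x < 1"
  shows "rho x < 1"
proof -
  have "rho x \<noteq> 1" using rho_quadratic[OF assms(1)] assms(2) by auto
  then show ?thesis using rho_le_1[of x] assms by simp
qed

lemma rho_ge_two_thirds:
  assumes "1/6 \<le> x"
  shows "2/3 \<le> rho x"
proof -
  have "sqrt (1/6 * (1/6 + 8)) = sqrt ((7/6)\<^sup>2)"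
    by (simp add: power2_eq_square)
  also have "\<dots> = 7/6" by (rule real_sqrt_unique) auto
  finally have r: "sqrt (1/6 * (1/6 + 8)) = (7/6::real)" .
  have "rho (1/6) = 2/3" unfolding rho_def r by simp
  then show ?thesis using rho_mono[of "1/6" x] assms by simp
qed

lemma delta_rho_less_1:
  assumes "0 < \<delta>" "\<delta> < 1" "0 \<le> x" "x \<le> 1"
  shows "\<delta> * rho x < 1"
proof -
  have "\<delta> * rho x < 1 * 1"
    using rho_le_1[of x] rho_pos(1)[of x] assms by (intro mult_less_le_imp_less) auto
  then show ?thesis by simp
qed

text \<open>Rationalises the denominator: with \<open>s = sqrt (x * (x + 8))\<close> the product of
  \<open>4 + x + s\<close> and \<open>4 + x - s\<close> is 16, and \<open>8 * rho x\<close> is the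
  first factor.\<close>

lemma qstar_eq:
  assumes "0 < \<delta>" "\<delta> < 1" "0 \<le> x" "x \<le> 1"
  shows "qstar \<delta> x = rho x * (1 - \<delta>) / (1 - \<delta> * rho x)"
proof -
  define s where "s = sqrt (x * (x + 8))"
  have s: "s\<^sup>2 = x * (x + 8)"
    using assms by (simp add: s_def)
  have r: "8 * rho x = 4 + x + s" unfolding rho_def s_def by simp
  have d1: "1 - \<delta> * rho x > 0" using delta_rho_less_1[OF assms] by simp
  have "8 * rho x * (4 - 2 * \<delta> + x - s) = (4 + x + s) * (4 - 2 * \<delta> + x - s)"
    by (simp add: r)
  also have "\<dots> = 16 - 2 * \<delta> * (4 + x + s)"
    using s by (simp add: algebra_simps power2_eq_square)
  also have "\<dots> = 16 - 16 * \<delta> * rho x" by (simp add: r[symmetric])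
  finally have e: "rho x * (4 - 2 * \<delta> + x - s) = 2 * (1 - \<delta> * rho x)" by simp
  then have "4 - 2 * \<delta> + x - s \<noteq> 0" using d1 by auto
  moreover have "2 * (1 - \<delta>) * (1 - \<delta> * rho x) = rho x * (1 - \<delta>) * (4 - 2 * \<delta> + x - s)"
    using e by algebra
  ultimately show ?thesis using d1 unfolding qstar_def s_def[symmetric]
    by (simp add: frac_eq_eq)
qed

lemma qstar_bounds:
  assumes "0 < \<delta>" "\<delta> < 1" "0 \<le> x" "x \<le> 1"
  shows "0 \<le> qstar \<delta> x" "qstar \<delta> x \<le> 1"
proof -
  have d1: "1 - \<delta> * rho x > 0" using delta_rho_less_1[OF assms] by simp
  then show "0 \<le> qstar \<delta> x" using assms rho_pos(1)[of x] by (simp add: qstar_eq)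
  have "rho x \<le> 1" using rho_le_1 assms by simp
  then show "qstar \<delta> x \<le> 1" using d1 assms by (simp add: qstar_eq algebra_simps)
qed

text \<open>The normalised payoff recursion when only zeros arrive: stop with probability
  \<open>qstar \<delta> x\<close>, otherwise discount once and face the same situation
  again.\<close>

lemma rho_fixed_point:
  assumes "0 < \<delta>" "\<delta> < 1" "0 \<le> x" "x \<le> 1"
  shows "rho x = qstar \<delta> x + (1 - qstar \<delta> x) * \<delta> * rho x"
proof -
  have d1: "1 - \<delta> * rho x \<noteq> 0" using delta_rho_less_1[OF assms] by simp
  have "qstar \<delta> x * (1 - \<delta> * rho x) = rho x * (1 - \<delta>)"
    using d1 assms by (simp add: qstar_eq)
  then show ?thesis by (simp add: algebra_simps)
qed

text \<open>
  Here \<open>S = rho y\<close> and \<open>t\<^sup>2 = rho x\<close>. The difference of the two sides is \<open>(1 - t) * K S\<close> with \<open>K\<close>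
  concave in \<open>S\<close>, so \<open>K\<close> only has to be checked at the end points \<open>2/3\<close> and \<open>t / e\<close>. The value \<open>2/3\<close>
  is \<open>rho (1/6)\<close>: this is where the threshold \<open>1/6\<close> comes from.
\<close>

lemma key_polynomial:
  fixes S t :: real
  assumes S: "2/3 \<le> S" "S * (1 + 2*t - 2*t\<^sup>2) < t" and t: "0 < t" "t \<le> 1"
  shows "((2*S-1)*t - S*(2*t\<^sup>2-1))\<^sup>2 \<le> (1-S)*(t\<^sup>2-S)*(2*t\<^sup>2-1)\<^sup>2"
proof -
  define e where "e = 1 + 2*t - 2*t\<^sup>2"
  define N where "N = 4*t^5 + 4*t^4 + 4*t^3 + 8*t^2 + t - 1"
  define K where "K = (\<lambda>S. - (4*t*(2*t+1))*S\<^sup>2 + N*S - 4*t^4*(1+t))"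
  define S1 where "S1 = t / e"
  have "0 \<le> t * (1 - t)" using t by simp
  then have e: "1 \<le> e" by (simp add: e_def power2_eq_square algebra_simps)
  have "S * e < t" using S(2) by (simp only: e_def)
  then have S1: "S < S1" using e by (simp add: S1_def field_simps)
  have "2/3 * e \<le> S * e" using S e by (intro mult_right_mono) auto
  then have "2 * e \<le> 3 * t" using \<open>S * e < t\<close> by simp
  \<comment> \<open>Since \<open>S\<close> is at least 2/3, the second hypothesis keeps
    \<open>t\<close> away from 0; this lower bound on \<open>t\<close> drives the rest.\<close>
  then have q: "0 \<le> 4*t\<^sup>2 - t - 2" by (simp add: e_def)
  have "0 \<le> t * t" by simp
  then have b: "0 \<le> 2 * t\<^sup>2 - 1" using q t by (simp add: power2_eq_square)
  \<comment> \<open>Polynomial division by \<open>4*t\<^sup>2 - t - 2\<close>; quotient and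
    remainder have positive coefficients.\<close>
  have "6*t^4 + 12*t^3 - 8*t - 3 = (4*t\<^sup>2 - t - 2) * (3/2*t\<^sup>2 + 27/8*t + 51/32) + (11/32*t + 3/16)"
    by algebra
  moreover have "0 \<le> (4*t\<^sup>2 - t - 2) * (3/2*t\<^sup>2 + 27/8*t + 51/32)"
    using q t by (intro mult_nonneg_nonneg) auto
  ultimately have "0 \<le> 6*t^4 + 12*t^3 - 8*t - 3" using t by linarith
  then have "0 \<le> (1 - t) * (6*t^4 + 12*t^3 - 8*t - 3)" using t by simp
  also have "\<dots> = 9/2 * K (2/3)" unfolding K_def N_def by algebra
  finally have K0: "0 \<le> K (2/3)" by simp
  have tS1: "t = S1 * e" using e by (simp add: S1_def)
  have "e\<^sup>2 * K S1 = - (4*t*(2*t+1))*(S1 * e)\<^sup>2 + N*(S1 * e)*e - 4*t^4*(1+t)*e\<^sup>2"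
    by (simp add: K_def algebra_simps power2_eq_square)
  also have "\<dots> = (1 + 2*t)*t*(1-t)*(2*t\<^sup>2-1)^3"
    unfolding tS1[symmetric] unfolding N_def e_def by algebra
  also have "\<dots> \<ge> 0" using t b by simp
  finally have K1: "0 \<le> K S1" using e by (simp add: zero_le_mult_iff)
  \<comment> \<open>Concavity as an exact identity: linear interpolation between the end points plus
    a remainder carrying the negated leading coefficient of \<open>K\<close>.\<close>
  have "(S1 - 2/3) * K S = (S1 - S) * K (2/3) + (S - 2/3) * K S1
      + (4*t*(2*t+1)) * ((S - 2/3) * (S1 - S) * (S1 - 2/3))"
    unfolding K_def by algebra
  moreover have "0 \<le> (S1 - S) * K (2/3)" "0 \<le> (S - 2/3) * K S1"
    "0 \<le> (4*t*(2*t+1)) * ((S - 2/3) * (S1 - S) * (S1 - 2/3))"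
    using S S1 t K0 K1 by auto
  ultimately have "0 \<le> (S1 - 2/3) * K S" by linarith
  then have "0 \<le> K S" using S S1 by (simp add: zero_le_mult_iff)
  then have "0 \<le> (1 - t) * K S" using t by simp
  also have "\<dots> = (1-S)*(t\<^sup>2-S)*(2*t\<^sup>2-1)\<^sup>2 - ((2*S-1)*t - S*(2*t\<^sup>2-1))\<^sup>2"
    unfolding K_def N_def by algebra
  finally show ?thesis by simp
qed

text \<open>
  With \<open>y\<close> the best alternative and \<open>c\<close> the reservation value, this says that \<open>x * rho x\<close> lies above
  the line through \<open>(c, rho y * c)\<close> of the slope for which \<open>rho y * max y c\<close> is a subsolution of
  the payoff recursion of the rule \<open>qstar\<close>.
\<close>

lemma rho_key:
  assumes "1/6 \<le> y" "y \<le> c" "c \<le> x" "x \<le> 1"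
  shows "rho y * (c - y) * (x - c) \<le> (1 - rho y) * c * (x * rho x - rho y * c)"
proof -
  define S where "S = rho y"
  define r where "r = rho x"
  define t where "t = sqrt r"
  define a where "a = 2 * S - 1"
  define b where "b = 2 * t\<^sup>2 - 1"
  have S: "2/3 \<le> S" "S \<le> 1" "S \<le> r" "S * y = a\<^sup>2"
    using assms rho_ge_two_thirds[of y] rho_le_1[of y] rho_mono[of y x] rho_quadratic[of y]
    by (auto simp: S_def r_def a_def)
  have r: "r \<le> 1" "0 < r" using rho_le_1[of x] assms S by (auto simp: r_def)
  have t2: "t\<^sup>2 = r" "0 < t" "t \<le> 1" using r by (auto simp: t_def)
  have x: "r * x = b\<^sup>2" using rho_quadratic[of x] assms by (simp add: b_def t2 r_def)
  have b0: "0 < b" using S t2 by (simp add: b_def)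
  have "S * (c - y) * (x - c) \<le> (1 - S) * c * (x * r - S * c)"
  \<comment> \<open>If \<open>S * c \<le> y\<close>, then \<open>c - y \<le> (1 - S) * c\<close>,
    and the factors can be compared one by one. Only the other case needs
    \<open>key_polynomial\<close>.\<close>
  proof (cases "S * c \<le> y")
    case True
    have "S * (c - y) * (x - c) \<le> S * ((1 - S) * c) * (x - c)"
      using True S assms by (intro mult_right_mono mult_left_mono) (auto simp: algebra_simps)
    also have "\<dots> = (1 - S) * c * (S * (x - c))" by simp
    also have "\<dots> \<le> (1 - S) * c * (x * r - S * c)"
      using S assms by (intro mult_left_mono) (auto simp: algebra_simps intro: mult_right_mono)
    finally show ?thesis .
  next
    case False
    \<comment> \<open>\<open>w\<close> is the square root of \<open>x\<close>, written so that it is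
      rational in \<open>b\<close> and \<open>t\<close>.\<close>
    define w where "w = b / t"
    have w: "w\<^sup>2 = x" "0 < w" "b = w * t" using x t2 b0 by (auto simp: w_def power_divide field_simps)
    have "a\<^sup>2 < S * (S * c)" using False S unfolding S(4)[symmetric] by (intro mult_strict_left_mono) auto
    also have "\<dots> \<le> (S * w)\<^sup>2" using assms S w by (auto simp: power2_eq_square intro!: mult_left_mono)
    finally have "a < S * w" using w S by (auto intro: power2_less_imp_less)
    then have "a * t < S * b" using w t2 by (simp add: mult_strict_right_mono)
    then have "S * (1 + 2*t - 2*t\<^sup>2) < t" by (simp add: a_def b_def algebra_simps)
    from key_polynomial[OF S(1) this t2(2,3)]
    have "(a * t - S * b)\<^sup>2 \<le> (1-S)*(t\<^sup>2-S)*b\<^sup>2" by (simp add: a_def b_def)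
    then have "t\<^sup>2 * (a - S * w)\<^sup>2 \<le> t\<^sup>2 * ((1-S)*(t\<^sup>2-S)*w\<^sup>2)"
      by (simp add: w algebra_simps power2_eq_square)
    then have "(a - S * w)\<^sup>2 \<le> (1-S)*(t\<^sup>2-S)*w\<^sup>2" using t2(2) by (simp del: t2(1))
    then have M: "a\<^sup>2 + S * x - (1 - S) * b\<^sup>2 \<le> 2 * S * a * w"
      unfolding w(3) w(1)[symmetric] by (simp add: algebra_simps power2_eq_square)
    \<comment> \<open>As a quadratic in \<open>c\<close>, the difference of the two sides has
      leading coefficient \<open>S\<^sup>2\<close> and constant term \<open>a\<^sup>2 * x\<close>.
      \<open>M\<close> bounds its linear coefficient from below by that of this square.\<close>
    have "0 \<le> (S * c - a * w)\<^sup>2" by simp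
    also have "\<dots> = S\<^sup>2 * c\<^sup>2 - (2 * S * a * w) * c + a\<^sup>2 * x"
      unfolding w(1)[symmetric] by algebra
    also have "\<dots> \<le> S\<^sup>2 * c\<^sup>2 - (a\<^sup>2 + S * x - (1 - S) * b\<^sup>2) * c + a\<^sup>2 * x"
      using M assms by (simp add: mult_right_mono)
    also have "\<dots> = (1 - S) * c * (x * r - S * c) - S * (c - y) * (x - c)"
      unfolding x[symmetric] S(4)[symmetric] by algebra
    finally show ?thesis by simp
  qed
  then show ?thesis by (simp add: S_def r_def)
qed

subsection \<open>Comparing time-dependent with constant stopping probabilities\<close>

text \<open>The solution is the expected value of \<open>\<beta> ^ k\<close> at the stopping time
  \<open>k\<close>, counted from \<open>t\<close>, when round \<open>t\<close> is stopped with
  probability \<open>q t\<close>. It serves as the normalised payoff along histories of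
  zeros.\<close>

lemma recursion_solution_exists:
  fixes q :: "nat \<Rightarrow> real"
  assumes q: "\<And>t. 0 \<le> q t" "\<And>t. q t \<le> 1" and b: "0 \<le> \<beta>" "\<beta> < 1"
  obtains D where "\<And>t. D t = q t + (1 - q t) * \<beta> * D (Suc t)" "\<And>t. 0 \<le> D t" "\<And>t. D t \<le> 1"
proof -
  define f where "f = (\<lambda>t k. (\<Prod>j<k. 1 - q (t + j)) * q (t + k) * \<beta> ^ k)"
  have f0: "0 \<le> f t k" for t k using q b by (auto simp: f_def intro!: mult_nonneg_nonneg prod_nonneg)
  have fS: "f t (Suc k) = (1 - q t) * \<beta> * f (Suc t) k" for t k
    unfolding f_def prod.lessThan_Suc_shift by simp
  have "(\<Prod>j<k. 1 - q (t + j)) \<le> 1" for t k using q by (intro prod_le_1) auto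
  then have "(\<Prod>j<k. 1 - q (t + j)) * q (t + k) \<le> 1 * 1" for t k
    using q by (intro mult_mono) auto
  then have "f t k \<le> 1 * \<beta> ^ k" for t k
    unfolding f_def using b by (intro mult_right_mono) auto
  then have sm: "summable (f t)" for t
    by (intro summable_comparison_test'[OF summable_geometric[of \<beta>], of 0]) (use b f0 in auto)
  have part: "(\<Sum>k<n. f t k) \<le> 1" for n t
  proof (induction n arbitrary: t)
    case (Suc n)
    have "(\<Sum>k<Suc n. f t k) = q t + (1 - q t) * (\<beta> * (\<Sum>k<n. f (Suc t) k))"
      unfolding sum.lessThan_Suc_shift by (simp add: fS sum_distrib_left mult.assoc) (simp add: f_def)
    also have "\<dots> \<le> q t + (1 - q t) * (1 * 1)"
      using q b Suc by (intro add_left_mono mult_left_mono mult_mono) (auto simp: f0 sum_nonneg)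
    finally show ?case by simp
  qed simp
  define D where "D = (\<lambda>t. \<Sum>k. f t k)"
  show thesis
  proof (rule that)
    show "D t = q t + (1 - q t) * \<beta> * D (Suc t)" for t
      unfolding D_def using suminf_split_head[OF sm[of t]] suminf_mult[OF sm[of "Suc t"], of "(1 - q t) * \<beta>"]
      by (simp add: fS) (simp add: f_def)
    show "0 \<le> D t" for t unfolding D_def by (intro suminf_nonneg sm f0)
    show "D t \<le> 1" for t unfolding D_def by (intro suminf_le_const sm part)
  qed
qed

text \<open>
  If \<open>D\<close> stayed below \<open>d\<close>, the combination \<open>h\<close> below, whose weight \<open>\<gamma>\<close> cancels the dependence of
  the recursion on \<open>q\<close>, would grow like \<open>\<delta> powr (- t)\<close> although it is bounded.
\<close>

lemma stationary_comparison:
  fixes q A D :: "nat \<Rightarrow> real"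
  assumes A: "\<And>t. A t = q t + (1 - q t) * \<delta> * A (Suc t)" "\<And>t. A t \<le> 1"
    and D: "\<And>t. D t = q t + (1 - q t) * \<beta> * D (Suc t)" "\<And>t. 0 \<le> D t"
    and q: "\<And>t. 0 \<le> q t" "\<And>t. q t \<le> 1"
    and \<beta>: "0 \<le> \<beta>" "\<beta> \<le> \<delta>" "0 < \<delta>" "\<delta> < 1"
    and a: "a = r + (1 - r) * \<delta> * a" "a \<le> 1" "a \<le> A 0"
    and d: "d = r + (1 - r) * \<beta> * d" "0 \<le> d" "d \<le> 1" "0 \<le> a"
  shows "\<exists>t. d \<le> D t"
proof (rule ccontr)
  assume "\<not> ?thesis"
  then have g: "D t < d" for t by (simp add: not_le)
  have "\<delta> * a < 1 * 1" using \<beta> a d by (cases "a = 1") (auto intro: mult_strict_mono le_less_trans[OF mult_left_le])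
  then have da: "0 < 1 - \<delta> * a" by simp
  define \<gamma> where "\<gamma> = (1 - \<beta> * d) / (1 - \<delta> * a)"
  have "\<beta> * d \<le> 1 * 1" using \<beta> d by (intro mult_mono) auto
  then have \<gamma>: "0 \<le> \<gamma>" using da by (simp add: \<gamma>_def)
  have \<gamma>e: "\<gamma> * (1 - \<delta> * a) = 1 - \<beta> * d" using da by (simp add: \<gamma>_def)
  define h where "h = (\<lambda>t. \<gamma> * (A t - a) - (D t - d))"
  have e_rec: "A t - a = (q t - r) * (1 - \<delta> * a) + (1 - q t) * \<delta> * (A (Suc t) - a)" for t
    using A(1)[of t] a(1) by algebra
  have g_rec: "D t - d = (q t - r) * (1 - \<beta> * d) + (1 - q t) * \<beta> * (D (Suc t) - d)" for t
    using D(1)[of t] d(1) by algebra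
  have h_rec: "h t = (1 - q t) * (\<delta> * h (Suc t) - (\<delta> - \<beta>) * (d - D (Suc t)))" for t
    unfolding h_def e_rec[of t] g_rec[of t] using \<gamma>e by algebra
  have h0: "0 < h 0" using a(3) g[of 0] mult_nonneg_nonneg[OF \<gamma>, of "A 0 - a"] unfolding h_def by linarith
  have grow: "0 < h t \<and> h 0 \<le> \<delta> ^ t * h t" for t
  proof (induction t)
    case (Suc t)
    define Z where "Z = \<delta> * h (Suc t) - (\<delta> - \<beta>) * (d - D (Suc t))"
    have ht: "h t = (1 - q t) * Z" by (simp add: Z_def h_rec[of t])
    then have Z: "0 < Z" using Suc q(2)[of t] by (auto simp: zero_less_mult_iff)
    have "h t \<le> 1 * Z" unfolding ht using Z q(1)[of t] by (intro mult_right_mono) auto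
    moreover have "0 \<le> (\<delta> - \<beta>) * (d - D (Suc t))" using \<beta> g[of "Suc t"] by simp
    ultimately have le: "h t \<le> \<delta> * h (Suc t)" by (simp add: Z_def)
    then have "0 < h (Suc t)" using Suc \<beta> by (smt (verit) zero_less_mult_pos)
    moreover have "\<delta> ^ t * h t \<le> \<delta> ^ Suc t * h (Suc t)"
      using le \<beta> by (simp add: mult_left_mono mult.left_commute)
    ultimately show ?case using Suc by simp
  qed (use h0 in simp)
  have "h t \<le> \<gamma> + 1" for t
  proof -
    have "\<gamma> * (A t - a) \<le> \<gamma> * 1" using \<gamma> A(2)[of t] d by (intro mult_left_mono) auto
    then show ?thesis using D(2)[of t] d unfolding h_def by simp
  qed
  then have bd: "h 0 \<le> \<delta> ^ t * (\<gamma> + 1)" for t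
    using grow[of t] \<beta> by (smt (verit) mult_left_mono zero_le_power)
  have "(\<lambda>t. \<delta> ^ t * (\<gamma> + 1)) \<longlonglongrightarrow> 0 * (\<gamma> + 1)"
    using \<beta> by (intro tendsto_mult LIMSEQ_power_zero tendsto_const) auto
  then have "h 0 \<le> 0" using bd by (intro LIMSEQ_le_const) auto
  then show False using h0 by simp
qed

subsection \<open>Lower integrals and products\<close>

text \<open>
  Decision rules need not be measurable, so \<open>integral\<^sup>N\<close> has to be treated as a lower integral: it
  is superadditive, and only one inequality of Fubini's theorem is available.
\<close>

lemma nn_integral_cmult_le:
  assumes "c \<noteq> top"
  shows "(\<integral>\<^sup>+ x. c * f x \<partial>M) \<le> c * integral\<^sup>N M f"
proof (cases "c = 0")
  case False
  show ?thesis
    unfolding nn_integral_def[of M "\<lambda>x. c * f x"]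
  proof (safe intro!: SUP_least)
    fix g assume g: "simple_function M g" "g \<le> (\<lambda>x. c * f x)"
    have c: "c * (u / c) = u" "c * u / c = u" for u :: ennreal
      using False assms by (auto simp: ennreal_times_divide mult.commute[of c] ennreal_mult_divide_eq)
    have [measurable]: "g \<in> borel_measurable M" using g by (simp add: borel_measurable_simple_function)
    have "g x / c \<le> f x" for x
      using divide_right_mono_ennreal[OF le_funD[OF g(2)], of x c] by (simp add: c)
    then have "c * (\<integral>\<^sup>+ x. g x / c \<partial>M) \<le> c * integral\<^sup>N M f"
      by (intro mult_left_mono nn_integral_mono) auto
    also have "c * (\<integral>\<^sup>+ x. g x / c \<partial>M) = integral\<^sup>N M g"
      by (subst nn_integral_cmult[symmetric]) (auto simp: c)
    finally show "integral\<^sup>S M g \<le> c * integral\<^sup>N M f" by (simp add: nn_integral_eq_simple_integral g)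
  qed
qed simp

text \<open>The sum of simple functions below \<open>f\<close> and \<open>g\<close> is a simple
  function below the sum, and on simple functions the integral is additive.\<close>

lemma nn_integral_superadditive:
  "integral\<^sup>N M f + integral\<^sup>N M g \<le> (\<integral>\<^sup>+ x. f x + g x \<partial>M)"
proof -
  let ?S = "\<lambda>f. {s. simple_function M s \<and> s \<le> f}"
  have ne: "?S f \<noteq> {}" for f :: "'a \<Rightarrow> ennreal"
    by (auto intro!: exI[of _ "\<lambda>x. 0"] simp: le_fun_def)
  have le: "integral\<^sup>S M s + integral\<^sup>S M u \<le> (\<integral>\<^sup>+ x. f x + g x \<partial>M)" if "s \<in> ?S f" "u \<in> ?S g" for s u
  proof -
    have "integral\<^sup>S M s + integral\<^sup>S M u = (\<integral>\<^sup>+ x. s x + u x \<partial>M)"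
      using that by (simp add: nn_integral_add nn_integral_eq_simple_integral[symmetric] borel_measurable_simple_function)
    also have "\<dots> \<le> (\<integral>\<^sup>+ x. f x + g x \<partial>M)"
      using that by (intro nn_integral_mono add_mono) (auto simp: le_fun_def)
    finally show ?thesis .
  qed
  have "(SUP u\<in>?S g. SUP s\<in>?S f. integral\<^sup>S M u + integral\<^sup>S M s) \<le> (\<integral>\<^sup>+ x. f x + g x \<partial>M)"
    by (intro SUP_least) (subst add.commute, rule le)
  then show ?thesis
    unfolding nn_integral_def[of M f] nn_integral_def[of M g]
    by (simp only: ennreal_SUP_add_right[OF ne] ennreal_SUP_add_left[OF ne, symmetric])
       (simp add: add.commute)
qed

lemma nn_integral_sum_superadditive:
  "(\<Sum>k<n. integral\<^sup>N M (f k)) \<le> (\<integral>\<^sup>+ x. (\<Sum>k<n::nat. f k x) \<partial>M)"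
proof (induction n)
  case (Suc n)
  then show ?case using nn_integral_superadditive[of M "\<lambda>x. \<Sum>k<n. f k x" "f n"]
    by (auto intro: order_trans add_right_mono)
qed simp

text \<open>Fubini with coordinate 0 outermost and the other coordinates shifted down by one: the
  first future alternative is about to join the history, and the rest again form an i.i.d. sequence
  indexed from 0.\<close>

lemma nn_integral_PiM_Suc:
  assumes F: "prob_space F" and g: "g \<in> borel_measurable (PiM {..<Suc k} (\<lambda>_. F))"
  shows "(\<integral>\<^sup>+ \<omega>. g \<omega> \<partial>PiM {..<Suc k} (\<lambda>_. F)) =
    (\<integral>\<^sup>+ x. \<integral>\<^sup>+ \<omega>. g ((\<lambda>n\<in>Suc ` {..<k}. \<omega> (n - 1))(0 := x)) \<partial>PiM {..<k} (\<lambda>_. F) \<partial>F)"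
    (is "_ = ?R")
proof -
  interpret F: prob_space F by fact
  interpret product_sigma_finite "\<lambda>_::nat. F" by standard
  let ?P = "PiM (Suc ` {..<k}) (\<lambda>_. F)" and ?s = "\<lambda>\<omega>. \<lambda>n\<in>Suc ` {..<k}. \<omega> (n - 1)"
  have ins: "{..<Suc k} = insert 0 (Suc ` {..<k})" by (simp add: lessThan_Suc_eq_insert_0)
  have g': "g \<in> borel_measurable (PiM (insert 0 (Suc ` {..<k})) (\<lambda>_. F))" using g by (simp add: ins)
  have upd: "(\<lambda>v. v(0 := x)) \<in> measurable ?P (PiM (insert 0 (Suc ` {..<k})) (\<lambda>_. F))" if "x \<in> space F" for x
    using that by (intro measurable_fun_upd[where J="Suc ` {..<k}"]) auto
  have sh: "?s \<in> measurable (PiM {..<k} (\<lambda>_. F)) ?P" by (intro measurable_restrict) auto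
  have d: "distr (PiM {..<k} (\<lambda>_. F)) ?P ?s = ?P"
    by (rule distr_PiM_reindex[where f="\<lambda>n. n - 1"]) (auto simp: F inj_on_def)
  have "(\<integral>\<^sup>+ \<omega>. g \<omega> \<partial>PiM {..<Suc k} (\<lambda>_. F)) = (\<integral>\<^sup>+ x. \<integral>\<^sup>+ v. g (v(0 := x)) \<partial>?P \<partial>F)"
    unfolding ins by (rule product_nn_integral_insert_rev) (use g' in auto)
  also have "\<dots> = ?R"
  proof (rule nn_integral_cong)
    fix x assume "x \<in> space F"
    then have "(\<lambda>v. g (v(0 := x))) \<in> borel_measurable ?P"
      by (rule measurable_compose[OF upd g'])
    then show "(\<integral>\<^sup>+ v. g (v(0 := x)) \<partial>?P) = (\<integral>\<^sup>+ \<omega>. g ((?s \<omega>)(0 := x)) \<partial>PiM {..<k} (\<lambda>_. F))"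
      by (subst d[symmetric], subst nn_integral_distr[OF sh]) auto
  qed
  finally show "(\<integral>\<^sup>+ \<omega>. g \<omega> \<partial>PiM {..<Suc k} (\<lambda>_. F)) = ?R" .
qed

subsection \<open>The recursion for the expected payoff\<close>

text \<open>The summand of \<open>payoff_env\<close> under the integral. Naming it allows the series
  to be treated in \<open>ennreal\<close>, before \<open>enn2real\<close> is applied.\<close>

definition stop_integrand :: "real \<Rightarrow> (real list \<Rightarrow> real) \<Rightarrow> real list \<Rightarrow> nat \<Rightarrow> (nat \<Rightarrow> real) \<Rightarrow> ennreal" where
  "stop_integrand \<delta> p h k \<omega> = ennreal ((\<Prod>j<k. (1 - p (h @ map \<omega> [0..<j]))) * p (h @ map \<omega> [0..<k])
               * \<delta> ^ k * best (h @ map \<omega> [0..<k]))"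

definition stop_payoff :: "real \<Rightarrow> (real list \<Rightarrow> real) \<Rightarrow> real measure \<Rightarrow> real list \<Rightarrow> nat \<Rightarrow> ennreal" where
  "stop_payoff \<delta> p F h k = (\<integral>\<^sup>+ \<omega>. stop_integrand \<delta> p h k \<omega> \<partial>(PiM {..<k} (\<lambda>_. F)))"

lemma payoff_env_eq: "payoff_env \<delta> p F h = enn2real (\<Sum>k. stop_payoff \<delta> p F h k)"
  by (simp add: payoff_env_def stop_payoff_def stop_integrand_def)

lemma stop_payoff_0: "stop_payoff \<delta> p F h 0 = ennreal (p h * best h)"
  by (simp add: stop_payoff_def stop_integrand_def PiM_empty nn_integral_count_space_finite)

text \<open>Moving the first alternative \<open>x\<close> from the future into the history costs the
  factor \<open>(1 - p h) * \<delta>\<close>, the chance of continuing times one round of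
  discounting.\<close>

lemma stop_integrand_Suc:
  assumes "decision_rule p" "0 \<le> \<delta>"
  shows "stop_integrand \<delta> p h (Suc k) ((\<lambda>n\<in>Suc ` {..<k}. \<omega> (n - 1))(0 := x))
    = ennreal ((1 - p h) * \<delta>) * stop_integrand \<delta> p (h @ [x]) k \<omega>"
proof -
  let ?w = "(\<lambda>n\<in>Suc ` {..<k}. \<omega> (n - 1))(0 := x)"
  have m: "h @ map ?w [0..<Suc j] = (h @ [x]) @ map \<omega> [0..<j]" if "j \<le> k" for j
    unfolding map_upt_Suc using that by auto
  have "(\<Prod>j<Suc k. 1 - p (h @ map ?w [0..<j]))
      = (1 - p h) * (\<Prod>j<k. 1 - p ((h @ [x]) @ map \<omega> [0..<j]))"
  proof -
    have "(\<Prod>j<k. 1 - p (h @ map ?w [0..<Suc j])) = (\<Prod>j<k. 1 - p ((h @ [x]) @ map \<omega> [0..<j]))"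
      by (intro prod.cong refl arg_cong[where f="\<lambda>z. 1 - p z"] m) auto
    then show ?thesis unfolding prod.lessThan_Suc_shift by simp
  qed
  moreover have "0 \<le> (1 - p h) * \<delta>" using assms by (simp add: decision_rule_def)
  ultimately show ?thesis
    unfolding stop_integrand_def m[OF order_refl] by (simp add: ennreal_mult'[symmetric] mult_ac)
qed

text \<open>The integrand may fail to be measurable, but every simple function below it is
  measurable. Fubini is applied to these minorants, which gives one inequality.\<close>

lemma stop_payoff_Suc_le:
  assumes "decision_rule p" "0 \<le> \<delta>" and F: "prob_space F"
  shows "stop_payoff \<delta> p F h (Suc k) \<le> ennreal ((1 - p h) * \<delta>) * (\<integral>\<^sup>+ x. stop_payoff \<delta> p F (h @ [x]) k \<partial>F)"
  unfolding stop_payoff_def[of _ _ _ _ "Suc k"] nn_integral_def[of "PiM {..<Suc k} (\<lambda>_. F)"]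
proof (safe intro!: SUP_least)
  let ?P = "PiM {..<Suc k} (\<lambda>_. F)" and ?w = "\<lambda>x \<omega>. (\<lambda>n\<in>Suc ` {..<k}. \<omega> (n - 1))(0 := x)"
  fix g assume g: "simple_function ?P g" "g \<le> (\<lambda>\<omega>. stop_integrand \<delta> p h (Suc k) \<omega>)"
  then have "g \<in> borel_measurable ?P" by (simp add: borel_measurable_simple_function)
  then have "integral\<^sup>S ?P g = (\<integral>\<^sup>+ x. \<integral>\<^sup>+ \<omega>. g (?w x \<omega>) \<partial>PiM {..<k} (\<lambda>_. F) \<partial>F)"
    using nn_integral_PiM_Suc[OF F] g by (simp add: nn_integral_eq_simple_integral[symmetric])
  also have "\<dots> \<le> (\<integral>\<^sup>+ x. \<integral>\<^sup>+ \<omega>. stop_integrand \<delta> p h (Suc k) (?w x \<omega>) \<partial>PiM {..<k} (\<lambda>_. F) \<partial>F)"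
    using g by (intro nn_integral_mono) (auto simp: le_fun_def)
  also have "\<dots> = (\<integral>\<^sup>+ x. \<integral>\<^sup>+ \<omega>. ennreal ((1 - p h) * \<delta>) * stop_integrand \<delta> p (h @ [x]) k \<omega> \<partial>PiM {..<k} (\<lambda>_. F) \<partial>F)"
    by (simp only: stop_integrand_Suc[OF assms(1,2)])
  also have "\<dots> \<le> (\<integral>\<^sup>+ x. ennreal ((1 - p h) * \<delta>) * stop_payoff \<delta> p F (h @ [x]) k \<partial>F)"
    unfolding stop_payoff_def by (intro nn_integral_mono nn_integral_cmult_le) auto
  also have "\<dots> \<le> ennreal ((1 - p h) * \<delta>) * (\<integral>\<^sup>+ x. stop_payoff \<delta> p F (h @ [x]) k \<partial>F)"
    by (intro nn_integral_cmult_le) auto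
  finally show "integral\<^sup>S ?P g \<le> \<dots>" .
qed

lemma best_append: "h \<noteq> [] \<Longrightarrow> best (h @ [x]) = max (best h) x"
  by (simp add: best_def max.commute)

lemma best_append_measurable:
  assumes "sets F = sets borel" "j \<le> k" "h \<noteq> []"
  shows "(\<lambda>\<omega>. best (h @ map \<omega> [0..<j])) \<in> borel_measurable (PiM {..<k} (\<lambda>_. F))"
  using assms(2)
proof (induction j)
  case (Suc j)
  have "(\<lambda>\<omega>. \<omega> j) \<in> measurable (PiM {..<k} (\<lambda>_. F)) F"
    using Suc by (intro measurable_component_singleton) auto
  then have [measurable]: "(\<lambda>\<omega>. \<omega> j) \<in> borel_measurable (PiM {..<k} (\<lambda>_. F))"
    using assms(1) by (simp cong: measurable_cong_sets)
  have [measurable]: "(\<lambda>\<omega>. best (h @ map \<omega> [0..<j])) \<in> borel_measurable (PiM {..<k} (\<lambda>_. F))"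
    using Suc by simp
  have "(\<lambda>\<omega>. best (h @ map \<omega> [0..<Suc j])) = (\<lambda>\<omega>. max (best (h @ map \<omega> [0..<j])) (\<omega> j))"
    using assms(3) by (auto simp: best_append[symmetric])
  then show ?case by simp
qed simp

lemma stop_integrand_measurable:
  assumes "sets F = sets borel" "h \<noteq> []" "\<phi> \<in> borel_measurable borel"
  shows "stop_integrand \<delta> (\<lambda>h. \<phi> (best h)) h k \<in> borel_measurable (PiM {..<k} (\<lambda>_. F))"
proof -
  note m = best_append_measurable[OF assms(1) _ assms(2)]
  note m' = measurable_compose[OF m assms(3)]
  have [measurable]: "(\<lambda>\<omega>. \<Prod>j<k. 1 - \<phi> (best (h @ map \<omega> [0..<j]))) \<in> borel_measurable (PiM {..<k} (\<lambda>_. F))"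
    by (intro borel_measurable_prod borel_measurable_diff m' borel_measurable_const) auto
  show ?thesis unfolding stop_integrand_def
    by (intro measurable_compose[OF _ measurable_ennreal] borel_measurable_times m m' borel_measurable_const) auto
qed

text \<open>With a Borel function \<open>\<phi>\<close> of the best alternative the integrand is
  measurable, so Fubini yields equality here.\<close>

lemma stop_payoff_Suc:
  assumes "decision_rule (\<lambda>h. \<phi> (best h))" "0 \<le> \<delta>" and F: "prob_space F"
    and m: "sets F = sets borel" "h \<noteq> []" "\<phi> \<in> borel_measurable borel"
  shows "stop_payoff \<delta> (\<lambda>h. \<phi> (best h)) F h (Suc k)
    = (\<integral>\<^sup>+ x. ennreal ((1 - \<phi> (best h)) * \<delta>) * stop_payoff \<delta> (\<lambda>h. \<phi> (best h)) F (h @ [x]) k \<partial>F)"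
  unfolding stop_payoff_def nn_integral_PiM_Suc[OF F stop_integrand_measurable[OF m]]
    stop_integrand_Suc[OF assms(1,2)]
  using m by (intro nn_integral_cong nn_integral_cmult stop_integrand_measurable) auto

text \<open>Under a rule that looks only at the best alternative the payoff is a function of it.\<close>

primrec best_payoff :: "real \<Rightarrow> (real \<Rightarrow> real) \<Rightarrow> real measure \<Rightarrow> nat \<Rightarrow> real \<Rightarrow> ennreal" where
  "best_payoff \<delta> \<phi> F 0 y = ennreal (\<phi> y * y)"
| "best_payoff \<delta> \<phi> F (Suc k) y = (\<integral>\<^sup>+ x. ennreal ((1 - \<phi> y) * \<delta>) * best_payoff \<delta> \<phi> F k (max y x) \<partial>F)"

lemma best_payoff_measurable:
  assumes F: "prob_space F" "sets F = sets borel" and [measurable]: "\<phi> \<in> borel_measurable borel"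
  shows "best_payoff \<delta> \<phi> F k \<in> borel_measurable borel"
proof (induction k)
  case (Suc k)
  note [measurable] = Suc
  interpret prob_space F by fact
  have [measurable]: "(\<lambda>x. x) \<in> borel_measurable F" using F by (simp cong: measurable_cong_sets)
  show ?case unfolding best_payoff.simps by measurable
qed simp

text \<open>Gives measurability in the next alternative: \<open>best_payoff\<close> is a Borel
  function of a real number, while \<open>stop_payoff\<close> takes a list.\<close>

lemma stop_payoff_eq_best_payoff:
  assumes "decision_rule (\<lambda>h. \<phi> (best h))" "0 \<le> \<delta>" "prob_space F"
    and "sets F = sets borel" "h \<noteq> []" "\<phi> \<in> borel_measurable borel"
  shows "stop_payoff \<delta> (\<lambda>h. \<phi> (best h)) F h k = best_payoff \<delta> \<phi> F k (best h)"
  using assms(5)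
proof (induction k arbitrary: h)
  case (Suc k)
  then show ?case
    using assms by (simp add: stop_payoff_Suc best_append)
qed (simp add: stop_payoff_0)

text \<open>Induction on the number of summands keeps every partial sum below \<open>W\<close>. Only
  inequalities valid for lower integrals enter, so neither \<open>p\<close> nor \<open>W\<close> has
  to be measurable. \<open>H\<close> is a set of histories that the search almost surely never
  leaves.\<close>

lemma payoff_supersolution:
  fixes W :: "real list \<Rightarrow> ennreal"
  assumes p: "decision_rule p" "0 \<le> \<delta>" and F: "prob_space F"
    and H: "\<And>h. h \<in> H \<Longrightarrow> AE x in F. h @ [x] \<in> H"
    and W: "\<And>h. h \<in> H \<Longrightarrow>
      ennreal (p h * best h) + ennreal ((1 - p h) * \<delta>) * (\<integral>\<^sup>+ x. W (h @ [x]) \<partial>F) \<le> W h"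
    and h: "h \<in> H"
  shows "(\<Sum>k. stop_payoff \<delta> p F h k) \<le> W h"
proof (rule suminf_le_const[OF summableI])
  show "(\<Sum>k<n. stop_payoff \<delta> p F h k) \<le> W h" for n
    using h
  proof (induction n arbitrary: h)
    case (Suc n)
    let ?c = "ennreal ((1 - p h) * \<delta>)"
    have "(\<Sum>k<n. stop_payoff \<delta> p F h (Suc k)) \<le> (\<Sum>k<n. ?c * (\<integral>\<^sup>+ x. stop_payoff \<delta> p F (h @ [x]) k \<partial>F))"
      by (intro sum_mono stop_payoff_Suc_le p F)
    also have "\<dots> \<le> ?c * (\<integral>\<^sup>+ x. (\<Sum>k<n. stop_payoff \<delta> p F (h @ [x]) k) \<partial>F)"
      unfolding sum_distrib_left[symmetric] by (intro mult_left_mono nn_integral_sum_superadditive) auto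
    also have "\<dots> \<le> ?c * (\<integral>\<^sup>+ x. W (h @ [x]) \<partial>F)"
      using H[OF Suc.prems] by (intro mult_left_mono nn_integral_mono_AE) (auto intro: Suc.IH)
    finally have "(\<Sum>k<Suc n. stop_payoff \<delta> p F h k) \<le> ennreal (p h * best h) + ?c * (\<integral>\<^sup>+ x. W (h @ [x]) \<partial>F)"
      unfolding sum.lessThan_Suc_shift stop_payoff_0 by (intro add_left_mono)
    then show ?case using W[OF Suc.prems] by (rule order_trans)
  qed simp
qed

text \<open>Unfolding the inequality \<open>n\<close> times leaves a remainder of at most
  \<open>\<delta> ^ n * K\<close>, which vanishes in the limit. The bound \<open>K\<close> excludes
  a \<open>W\<close> sustained by rewards that are postponed forever.\<close>

lemma payoff_subsolution:
  fixes W :: "real list \<Rightarrow> ennreal"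
  assumes p: "decision_rule (\<lambda>h. \<phi> (best h))" "0 \<le> \<delta>" "\<delta> < 1" and F: "prob_space F" "sets F = sets borel"
    and \<phi>: "\<phi> \<in> borel_measurable borel"
    and H: "\<And>h. h \<in> H \<Longrightarrow> h \<noteq> [] \<and> (AE x in F. h @ [x] \<in> H)"
    and W: "\<And>h. h \<in> H \<Longrightarrow> W h \<le> ennreal (\<phi> (best h) * best h)
        + ennreal ((1 - \<phi> (best h)) * \<delta>) * (\<integral>\<^sup>+ x. W (h @ [x]) \<partial>F)"
    and K: "\<And>h. h \<in> H \<Longrightarrow> W h \<le> ennreal K" "0 \<le> K"
    and h: "h \<in> H"
  shows "W h \<le> (\<Sum>k. stop_payoff \<delta> (\<lambda>h. \<phi> (best h)) F h k)"
proof -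
  interpret prob_space F by fact
  let ?T = "\<lambda>h k. stop_payoff \<delta> (\<lambda>h. \<phi> (best h)) F h k"
  have Fm [measurable]: "(\<lambda>x. x) \<in> borel_measurable F" using F by (simp cong: measurable_cong_sets)
  have bm: "(\<lambda>x. best_payoff \<delta> \<phi> F k (max y x)) \<in> borel_measurable F" for k y
    by (rule measurable_compose[OF _ best_payoff_measurable[OF F \<phi>]]) measurable
  have Tm: "(\<lambda>x. ?T (h @ [x]) k) \<in> borel_measurable F" if "h \<noteq> []" for h k
  proof -
    have "(\<lambda>x. ?T (h @ [x]) k) = (\<lambda>x. best_payoff \<delta> \<phi> F k (max (best h) x))"
      using that by (auto simp: stop_payoff_eq_best_payoff[OF p(1,2) F _ \<phi>] best_append)
    then show ?thesis using bm by simp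
  qed
  have main: "W h \<le> (\<Sum>k<n. ?T h k) + ennreal (\<delta> ^ n * K)" if "h \<in> H" for n h
    using that
  proof (induction n arbitrary: h)
    case 0
    then show ?case using K by simp
  next
    case (Suc n)
    note hH = H[OF Suc.prems]
    note [measurable] = Tm[OF hH[THEN conjunct1]]
    let ?c = "ennreal ((1 - \<phi> (best h)) * \<delta>)"
    have c: "0 \<le> 1 - \<phi> (best h)" "1 - \<phi> (best h) \<le> 1" using p(1) by (auto simp: decision_rule_def)
    have "?c * (\<integral>\<^sup>+ x. W (h @ [x]) \<partial>F) \<le> ?c * (\<integral>\<^sup>+ x. (\<Sum>k<n. ?T (h @ [x]) k) + ennreal (\<delta> ^ n * K) \<partial>F)"
      using hH by (intro mult_left_mono nn_integral_mono_AE) (auto intro: Suc.IH)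
    also have "\<dots> = ?c * (\<integral>\<^sup>+ x. (\<Sum>k<n. ?T (h @ [x]) k) \<partial>F) + ?c * ennreal (\<delta> ^ n * K)"
      by (subst nn_integral_add) (auto simp: emeasure_space_1 distrib_left)
    also have "?c * (\<integral>\<^sup>+ x. (\<Sum>k<n. ?T (h @ [x]) k) \<partial>F) = (\<Sum>k<n. ?T h (Suc k))"
      using hH by (simp add: nn_integral_sum sum_distrib_left stop_payoff_Suc[OF p(1,2) F(1,2) _ \<phi>] nn_integral_cmult)
    also have "?c * ennreal (\<delta> ^ n * K) \<le> ennreal (\<delta> ^ Suc n * K)"
    proof -
      have "(1 - \<phi> (best h)) * (\<delta> * (\<delta> ^ n * K)) \<le> 1 * (\<delta> * (\<delta> ^ n * K))"
        using c p K by (intro mult_right_mono) auto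
      then show ?thesis using p K c by (simp add: ennreal_mult'[symmetric] mult_ac)
    qed
    finally have "W h \<le> ennreal (\<phi> (best h) * best h) + ((\<Sum>k<n. ?T h (Suc k)) + ennreal (\<delta> ^ Suc n * K))"
      using W[OF Suc.prems] by (auto intro: order_trans add_left_mono)
    then show ?case unfolding sum.lessThan_Suc_shift stop_payoff_0 by (simp add: add.assoc)
  qed
  have "W h \<le> (\<Sum>k. ?T h k) + ennreal (\<delta> ^ n * K)" for n
    using main[OF h, of n] by (rule order_trans) (auto intro!: add_right_mono sum_le_suminf summableI)
  moreover have "(\<lambda>n. (\<Sum>k. ?T h k) + ennreal (\<delta> ^ n * K)) \<longlonglongrightarrow> (\<Sum>k. ?T h k) + ennreal (0 * K)"
    using p by (intro tendsto_add tendsto_const tendsto_ennrealI tendsto_mult LIMSEQ_power_zero) auto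
  ultimately have "W h \<le> (\<Sum>k. ?T h k) + ennreal (0 * K)"
    by (intro LIMSEQ_le_const) auto
  then show ?thesis by simp
qed

subsection \<open>Environments on a two-point set\<close>

definition two_point :: "real \<Rightarrow> real \<Rightarrow> real measure" where
  "two_point \<sigma> x = distr (measure_pmf (bernoulli_pmf \<sigma>)) borel (\<lambda>b. if b then x else 0)"

lemma two_point_basic: "prob_space (two_point \<sigma> x)" "sets (two_point \<sigma> x) = sets borel"
  by (auto simp: two_point_def intro!: prob_space.prob_space_distr prob_space_measure_pmf)

lemma AE_two_point: "AE z in two_point \<sigma> x. z = 0 \<or> z = x"
  unfolding two_point_def by (subst AE_distr_iff) auto

lemma nn_integral_two_point:
  assumes "0 \<le> \<sigma>" "\<sigma> \<le> 1"
  shows "(\<integral>\<^sup>+ z. f z \<partial>two_point \<sigma> x) = f x * ennreal \<sigma> + f 0 * ennreal (1 - \<sigma>)"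
proof -
  \<comment> \<open>\<open>f\<close> need not be measurable; \<open>?g\<close> is, and it agrees
    with \<open>f\<close> almost surely.\<close>
  let ?g = "\<lambda>z. if z = x then f x else f 0"
  have "(\<integral>\<^sup>+ z. f z \<partial>two_point \<sigma> x) = (\<integral>\<^sup>+ z. ?g z \<partial>two_point \<sigma> x)"
    using AE_two_point by (intro nn_integral_cong_AE, eventually_elim) auto
  also have "\<dots> = (\<integral>\<^sup>+ b. ?g (if b then x else 0) \<partial>measure_pmf (bernoulli_pmf \<sigma>))"
    unfolding two_point_def by (rule nn_integral_distr) auto
  also have "\<dots> = f x * ennreal \<sigma> + f 0 * ennreal (1 - \<sigma>)"
    using assms by (subst nn_integral_bernoulli_pmf) auto
  finally show ?thesis .
qed

lemma measure_two_point_zero: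
  assumes "0 \<le> \<sigma>" "\<sigma> \<le> 1" "x \<noteq> 0"
  shows "measure (two_point \<sigma> x) {0} = 1 - \<sigma>"
proof -
  have "emeasure (two_point \<sigma> x) {0} = (\<integral>\<^sup>+ z. indicator {0} z \<partial>two_point \<sigma> x)"
    by (simp add: two_point_basic)
  also have "\<dots> = ennreal (1 - \<sigma>)" using assms by (simp add: nn_integral_two_point)
  finally show ?thesis using assms by (simp add: measure_def)
qed

lemma two_point_environment:
  assumes "X \<in> sets borel" "0 \<in> X" "x \<in> X \<or> \<sigma> = 0" "0 \<le> \<sigma>" "\<sigma> \<le> 1"
  shows "two_point \<sigma> x \<in> environments X"
proof -
  have "emeasure (two_point \<sigma> x) X = (\<integral>\<^sup>+ z. indicator X z \<partial>two_point \<sigma> x)"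
    using assms by (simp add: two_point_basic)
  also have "\<dots> = 1" using assms by (auto simp: nn_integral_two_point ennreal_plus[symmetric] simp del: ennreal_plus)
  finally have "emeasure (two_point \<sigma> x) X = 1" .
  moreover have "integrable (two_point \<sigma> x) (\<lambda>z. z)"
    unfolding two_point_def by (subst integrable_distr_eq) (auto intro!: integrable_measure_pmf_finite)
  ultimately show ?thesis by (simp add: environments_def two_point_basic)
qed

lemma zeros_append: "(y # replicate t 0) @ [0] = y # replicate (Suc t) 0"
  by (simp add: replicate_append_same)

lemma best_zeros: "0 \<le> y \<Longrightarrow> best (y # replicate t 0) = y"
  by (induction t) (simp_all only: zeros_append[symmetric] best_append, simp_all add: best_def)

lemma consistent_zeros:
  assumes "0 \<le> \<sigma>" "\<sigma> < 1" "x \<noteq> 0"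
  shows "consistent_env (two_point \<sigma> x) (y # replicate t 0)"
  using assms by (simp add: consistent_env_def likelihood_def measure_two_point_zero prod_list_replicate)

subsection \<open>Reservation values and the payoff of pstar\<close>

locale search =
  fixes \<delta> xbar :: real and X :: "real set"
  assumes delta: "0 < \<delta>" "\<delta> < 1"
    and X_borel: "X \<in> sets borel" and X_nonneg: "X \<subseteq> {0..}" and X_zero: "0 \<in> X"
    and X_bdd: "bdd_above X" and xbar: "xbar = Sup X"
begin

lemma X_bounds: "x \<in> X \<Longrightarrow> 0 \<le> x" "x \<in> X \<Longrightarrow> x \<le> xbar"
  using X_nonneg X_bdd xbar by (auto intro: cSup_upper)

lemma xbar_nonneg: "0 \<le> xbar"
  using X_bounds X_zero by auto

lemma environmentD:
  assumes "F \<in> environments X"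
  shows "prob_space F" "sets F = sets borel" "integrable F (\<lambda>x. x)" "AE x in F. x \<in> X"
proof -
  interpret prob_space F using assms by (simp add: environments_def)
  show F: "prob_space F" "sets F = sets borel" "integrable F (\<lambda>x. x)"
    using assms by (simp_all add: environments_def)
  show "AE x in F. x \<in> X"
    using assms X_borel by (intro AE_prob_1) (simp add: environments_def emeasure_eq_measure)
qed

section \<open>The reservation equation\<close>

lemma integrable_max:
  assumes "F \<in> environments X"
  shows "integrable F (\<lambda>x. max c x :: real)"
proof -
  interpret prob_space F using environmentD(1)[OF assms] .
  show ?thesis using environmentD(3)[OF assms] by (intro integrable_max) auto
qed

lemma integral_max_mono:
  assumes F: "F \<in> environments X" and "c \<le> d"
  shows "(\<integral>x. max c x \<partial>F) \<le> (\<integral>x. max d x \<partial>F)"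
    and "(\<integral>x. max d x \<partial>F) \<le> (\<integral>x. max c x \<partial>F) + (d - c)"
proof -
  interpret prob_space F using environmentD(1)[OF F] .
  show "(\<integral>x. max c x \<partial>F) \<le> (\<integral>x. max d x \<partial>F)"
    using assms(2) by (intro integral_mono integrable_max F) auto
  have "(\<integral>x. max d x \<partial>F) \<le> (\<integral>x. max c x + (d - c) \<partial>F)"
    using assms(2) by (intro integral_mono integrable_max F Bochner_Integration.integrable_add) auto
  also have "\<dots> = (\<integral>x. max c x \<partial>F) + (d - c)"
    using integrable_max[OF F, of c] by (simp add: prob_space)
  finally show "(\<integral>x. max d x \<partial>F) \<le> (\<integral>x. max c x \<partial>F) + (d - c)" .
qed

definition reservation_value :: "real measure \<Rightarrow> real \<Rightarrow> bool" where
  "reservation_value F c \<longleftrightarrow> 0 \<le> c \<and> c \<le> xbar \<and> \<delta> * (\<integral>x. max c x \<partial>F) = c"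

definition reservation :: "real measure \<Rightarrow> real" where
  "reservation F = (SOME c. reservation_value F c)"

text \<open>Intermediate value theorem for
  \<open>\<delta> * (\<integral>x. max c x \<partial>F) - c\<close>, which is nonnegative at 0 and
  nonpositive at \<open>xbar\<close>. Continuity holds because the integral is 1-Lipschitz in
  \<open>c\<close>.\<close>

lemma reservation:
  assumes F: "F \<in> environments X"
  shows "0 \<le> reservation F" "reservation F \<le> xbar" "\<delta> * (\<integral>x. max (reservation F) x \<partial>F) = reservation F"
proof -
  interpret prob_space F using environmentD(1)[OF F] .
  let ?e = "\<lambda>c. (\<integral>x. max c x \<partial>F)"
  have ub: "AE x in F. max xbar x = xbar"
    using environmentD(4)[OF F] by eventually_elim (use X_bounds in auto)
  have "?e xbar = (\<integral>x. xbar \<partial>F)"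
    using integrable_max[OF F, of xbar] by (intro integral_cong_AE ub) auto
  also have "\<dots> = xbar" by (simp add: prob_space)
  finally have e1: "\<delta> * ?e xbar - xbar \<le> 0"
    using delta xbar_nonneg mult_right_mono[of \<delta> 1 xbar] by simp
  have "0 \<le> ?e 0" by simp
  then have e0: "0 \<le> \<delta> * ?e 0 - 0" using delta by simp
  have "1-lipschitz_on {0..xbar} ?e"
  proof (rule lipschitz_on_leI)
    fix x y :: real assume "x \<le> y"
    then show "dist (?e x) (?e y) \<le> 1 * dist x y"
      using integral_max_mono[OF F, of x y] by (simp add: dist_real_def)
  qed auto
  then have "continuous_on {0..xbar} (\<lambda>c. \<delta> * ?e c - c)"
    by (intro continuous_intros lipschitz_on_continuous_on)
  from IVT2'[of "\<lambda>c. \<delta> * ?e c - c" xbar 0 0, OF e1 e0 xbar_nonneg this]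
  obtain c where "0 \<le> c" "c \<le> xbar" "\<delta> * ?e c = c" by auto
  then have "reservation_value F c" by (simp add: reservation_value_def)
  then have "reservation_value F (reservation F)" unfolding reservation_def by (rule someI)
  then show "0 \<le> reservation F" "reservation F \<le> xbar" "\<delta> * ?e (reservation F) = reservation F"
    by (auto simp: reservation_value_def)
qed

text \<open>Raising \<open>c\<close> to \<open>z\<close> raises the expectation by at most
  \<open>z - c\<close>, and discounting shrinks this further.\<close>

lemma reservation_supersolution:
  assumes F: "F \<in> environments X" and "reservation F \<le> z"
  shows "\<delta> * (\<integral>x. max z x \<partial>F) \<le> z"
proof -
  let ?c = "reservation F"
  have "\<delta> * (\<integral>x. max z x \<partial>F) \<le> \<delta> * ((\<integral>x. max ?c x \<partial>F) + (z - ?c))"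
    using integral_max_mono[OF F assms(2)] delta by simp
  also have "\<dots> = ?c + \<delta> * (z - ?c)" using reservation[OF F] by (simp add: distrib_left)
  also have "\<dots> \<le> ?c + 1 * (z - ?c)" using assms delta by (intro add_left_mono mult_right_mono) auto
  finally show ?thesis by simp
qed

text \<open>The right-hand side is a supersolution for every rule at once: after one more draw it
  becomes \<open>max z x\<close>, with \<open>z\<close> its present value, and
  \<open>reservation_supersolution\<close> applies to \<open>z\<close>.\<close>

lemma payoff_upper:
  assumes F: "F \<in> environments X" and p: "decision_rule p" and h: "h \<noteq> []" "0 \<le> best h"
  shows "(\<Sum>k. stop_payoff \<delta> p F h k) \<le> ennreal (max (best h) (reservation F))"
proof (rule payoff_supersolution[where H="{h. h \<noteq> [] \<and> 0 \<le> best h}"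
      and W="\<lambda>h. ennreal (max (best h) (reservation F))"])
  fix h :: "real list" assume "h \<in> {h. h \<noteq> [] \<and> 0 \<le> best h}"
  then have h: "h \<noteq> []" "0 \<le> best h" by auto
  define z where "z = max (best h) (reservation F)"
  have z: "0 \<le> z" "reservation F \<le> z" "best h \<le> z" using h by (auto simp: z_def)
  have ph: "0 \<le> p h" "p h \<le> 1" using p by (auto simp: decision_rule_def)
  show "AE x in F. h @ [x] \<in> {h. h \<noteq> [] \<and> 0 \<le> best h}"
    using h by (auto simp: best_append)
  have "max (best (h @ [x])) (reservation F) = max z x" for x
    using h by (simp add: best_append z_def max_def)
  then have "(\<integral>\<^sup>+ x. ennreal (max (best (h @ [x])) (reservation F)) \<partial>F) = (\<integral>\<^sup>+ x. ennreal (max z x) \<partial>F)"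
    by simp
  also have "\<dots> = ennreal (\<integral>x. max z x \<partial>F)"
    using z by (intro nn_integral_eq_integral integrable_max F) auto
  finally have "ennreal (p h * best h) + ennreal ((1 - p h) * \<delta>) *
      (\<integral>\<^sup>+ x. ennreal (max (best (h @ [x])) (reservation F)) \<partial>F)
    = ennreal (p h * best h) + ennreal ((1 - p h) * (\<delta> * (\<integral>x. max z x \<partial>F)))"
    using ph delta by (simp only: ennreal_mult'[symmetric] mult.assoc mult_nonneg_nonneg diff_ge_0_iff_ge less_imp_le)
  also have "\<dots> \<le> ennreal (p h * z) + ennreal ((1 - p h) * z)"
    using ph z reservation_supersolution[OF F z(2)]
    by (intro add_mono ennreal_leI mult_left_mono) auto
  also have "\<dots> = ennreal z"
    using ph z by (subst ennreal_plus[symmetric]) (auto simp: left_diff_distrib intro: mult_left_le_one_le)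
  finally show "ennreal (p h * best h) + ennreal ((1 - p h) * \<delta>) *
      (\<integral>\<^sup>+ x. ennreal (max (best (h @ [x])) (reservation F)) \<partial>F)
    \<le> ennreal (max (best h) (reservation F))" by (simp add: z_def)
qed (use assms delta environmentD in auto)

lemma payoff_env_upper:
  assumes "F \<in> environments X" "decision_rule p" "h \<noteq> []" "0 \<le> best h"
  shows "payoff_env \<delta> p F h \<le> max (best h) (reservation F)"
  unfolding payoff_env_eq using payoff_upper[OF assms] assms(4) by (intro enn2real_leI) auto

lemma payoff_env_geI:
  assumes "F \<in> environments X" "decision_rule p" "h \<noteq> []" "0 \<le> best h"
    and "ennreal w \<le> (\<Sum>k. stop_payoff \<delta> p F h k)" "0 \<le> w"
  shows "w \<le> payoff_env \<delta> p F h"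
proof -
  \<comment> \<open>\<open>enn2real\<close> sends \<open>top\<close> to 0, so the series must be
    finite before a lower bound can pass to the reals.\<close>
  have "(\<Sum>k. stop_payoff \<delta> p F h k) < top"
    using payoff_upper[OF assms(1-4)] by (rule le_less_trans) simp
  from enn2real_mono[OF assms(5) this] show ?thesis using assms(6) by (simp add: payoff_env_eq)
qed

lemma decision_rule_stop: "decision_rule (\<lambda>_. 1)"
  by (simp add: decision_rule_def)

lemma payoff_env_stop:
  assumes "F \<in> environments X" "h \<noteq> []" "0 \<le> best h"
  shows "best h \<le> payoff_env \<delta> (\<lambda>_. 1) F h"
proof (rule payoff_env_geI[OF assms(1) decision_rule_stop assms(2,3) _ assms(3)])
  show "ennreal (best h) \<le> (\<Sum>k. stop_payoff \<delta> (\<lambda>_. 1) F h k)"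
    using sum_le_suminf[OF summableI, of "{0::nat}" "stop_payoff \<delta> (\<lambda>_. 1) F h"]
    by (simp add: stop_payoff_0)
qed

lemma decision_rule_pstar: "decision_rule (pstar \<delta> xbar)"
  using delta by (auto simp: decision_rule_def pstar_def intro!: qstar_bounds)

lemma payoff_env_pstar_lower:
  assumes F: "F \<in> environments X" and pos: "0 < xbar" and h: "h \<noteq> []" "1/6 \<le> best h / xbar" "best h \<le> xbar"
  shows "rho (best h / xbar) * max (best h) (reservation F) \<le> payoff_env \<delta> (pstar \<delta> xbar) F h"
proof -
  define \<phi> where "\<phi> = (\<lambda>y. qstar \<delta> (max 0 (min 1 (y / xbar))))"
  define c where "c = reservation F"
  define H where "H = {h. h \<noteq> [] \<and> 1/6 \<le> best h / xbar \<and> best h \<le> xbar}"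
  have p: "pstar \<delta> xbar = (\<lambda>h. \<phi> (best h))" by (simp add: \<phi>_def pstar_def fun_eq_iff)
  have \<phi>m: "\<phi> \<in> borel_measurable borel" unfolding \<phi>_def qstar_def by measurable
  note F' = environmentD[OF F]
  interpret prob_space F by fact
  have best_pos: "0 < best h" if "h \<in> H" for h
    using that pos by (auto simp: H_def field_simps)
  have c: "0 \<le> c" "c \<le> xbar" "\<delta> * (\<integral>x. max c x \<partial>F) = c"
    using reservation[OF F] by (auto simp: c_def)
  have "ennreal (rho (best h / xbar) * max (best h) c) \<le> (\<Sum>k. stop_payoff \<delta> (\<lambda>h. \<phi> (best h)) F h k)"
  proof (rule payoff_subsolution[where H=H and K=xbar and W="\<lambda>h. ennreal (rho (best h / xbar) * max (best h) c)"])
    show "decision_rule (\<lambda>h. \<phi> (best h))" using decision_rule_pstar by (simp add: p)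
  next
    fix h assume hH: "h \<in> H"
    have "AE x in F. h @ [x] \<in> H"
      using F'(4)
    proof eventually_elim
      case (elim x)
      then show ?case using hH X_bounds[of x] pos by (auto simp: H_def best_append field_simps)
    qed
    then show "h \<noteq> [] \<and> (AE x in F. h @ [x] \<in> H)" using hH by (simp add: H_def)
    have "rho (best h / xbar) * max (best h) c \<le> 1 * xbar"
      using hH c pos best_pos[OF hH] by (intro mult_mono rho_le_1) (auto simp: H_def)
    then show "ennreal (rho (best h / xbar) * max (best h) c) \<le> ennreal xbar"
      by (intro ennreal_leI) simp
    define y where "y = best h"
    define S where "S = rho (y / xbar)"
    define q where "q = \<phi> y"
    have y: "1/6 \<le> y / xbar" "y / xbar \<le> 1" "0 < y" "y \<le> xbar" "h \<noteq> []"
      using hH pos best_pos[OF hH] by (auto simp: H_def y_def)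
    have q: "q = qstar \<delta> (y / xbar)" "0 \<le> q" "q \<le> 1" using y delta by (auto simp: q_def \<phi>_def qstar_bounds)
    have S: "S = q + (1 - q) * \<delta> * S" unfolding S_def q by (rule rho_fixed_point) (use y delta in auto)
    have S0: "0 < S" "S \<le> 1" using rho_pos(1)[of "y / xbar"] rho_le_1[of "y / xbar"] y by (auto simp: S_def)
    have mono: "S \<le> rho (x / xbar)" if "y \<le> x" for x
      unfolding S_def using that y pos by (intro rho_mono) (auto simp: divide_right_mono)
    \<comment> \<open>A minorant of the next value that is affine in \<open>max (max y c) x\<close>,
      so that the reservation equation determines its expectation when \<open>y < c\<close>. For
      \<open>c \<le> y\<close> slope 0 suffices, by the fixed point equation
      \<open>S\<close>.\<close>
    obtain m where m: "0 \<le> m" "\<And>x. x \<in> X \<Longrightarrow> S * max y c + m * (max (max y c) x - max y c) \<le> rho (max y x / xbar) * max (max y x) c"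
      and fin: "S * max y c \<le> q * y + (1 - q) * \<delta> * (S * max y c + m * ((\<integral>x. max (max y c) x \<partial>F) - max y c))"
    proof (cases "c \<le> y")
      case True
      show thesis
      proof (rule that[of 0])
        fix x
        have "S * y \<le> rho (max y x / xbar) * max y x"
          using mono[of "max y x"] y S0 by (intro mult_mono) auto
        then show "S * max y c + 0 * (max (max y c) x - max y c) \<le> rho (max y x / xbar) * max (max y x) c"
          using True by (simp add: max_absorb1)
      next
        have "S * y = (q + (1 - q) * \<delta> * S) * y" using S by simp
        then show "S * max y c \<le> q * y + (1 - q) * \<delta> * (S * max y c + 0 * ((\<integral>x. max (max y c) x \<partial>F) - max y c))"
          using True by (simp add: max_absorb1 algebra_simps)
      qed simp
    next
      case False
      then have "y / xbar < 1" using c pos by (simp add: field_simps)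
      then have S1: "S < 1" unfolding S_def using y by (intro rho_less_1) auto
      \<comment> \<open>The slope that turns \<open>fin\<close> into an equality; that the line then
        stays below the next value is \<open>rho_key\<close>, rescaled by
        \<open>xbar\<close>.\<close>
      define m where "m = S * (c - y) / ((1 - S) * c)"
      have c0: "0 < c" using False y by simp
      have m_eq: "m * ((1 - S) * c) = S * (c - y)" using S1 c0 by (simp add: m_def)
      show thesis
      proof (rule that[of m])
        show "0 \<le> m" using S0 S1 c0 False by (simp add: m_def)
      next
        fix x assume x: "x \<in> X"
        show "S * max y c + m * (max (max y c) x - max y c) \<le> rho (max y x / xbar) * max (max y x) c"
        proof (cases "x \<le> c")
          case True
          have "S * c \<le> rho (max y x / xbar) * c" using mono[of "max y x"] c by (intro mult_right_mono) auto
          then show ?thesis using True False by (simp add: max_absorb1 max_absorb2)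
        next
          case x': False
          have "S * (c / xbar - y / xbar) * (x / xbar - c / xbar) \<le> (1 - S) * (c / xbar) * (x / xbar * rho (x / xbar) - S * (c / xbar))"
            unfolding S_def using x x' False y pos X_bounds[OF x] by (intro rho_key) (auto simp: divide_right_mono)
          then have "S * (c - y) * (x - c) / xbar\<^sup>2 \<le> (1 - S) * c * (x * rho (x / xbar) - S * c) / xbar\<^sup>2"
            by (simp add: diff_divide_distrib[symmetric] power2_eq_square)
          then have "S * (c - y) * (x - c) \<le> (1 - S) * c * (x * rho (x / xbar) - S * c)"
            using pos by (simp add: divide_le_cancel)
          then have "((1 - S) * c) * (m * (x - c)) \<le> ((1 - S) * c) * (x * rho (x / xbar) - S * c)"
            unfolding m_eq[symmetric] by (simp add: mult_ac)
          then have "m * (x - c) \<le> x * rho (x / xbar) - S * c"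
            using S1 c0 by simp
          then show ?thesis using x' False by (simp add: max_absorb1 max_absorb2 mult.commute)
        qed
      next
        have "\<delta> * (S * c + m * ((\<integral>x. max c x \<partial>F) - c)) = \<delta> * S * c + m * (\<delta> * (\<integral>x. max c x \<partial>F) - \<delta> * c)"
          by (simp add: algebra_simps)
        also have "\<dots> = \<delta> * S * c + (1 - \<delta>) * (m * c)" by (simp add: c(3)) (simp add: algebra_simps)
        finally have e: "\<delta> * (S * c + m * ((\<integral>x. max c x \<partial>F) - c)) = \<delta> * S * c + (1 - \<delta>) * (m * c)" .
        have q': "q * (1 - \<delta> * S) = S * (1 - \<delta>)" "(1 - q) * (1 - \<delta> * S) = 1 - S"
          using S by algebra+
        have "\<delta> * S < 1 * 1" using delta S0 by (intro mult_less_le_imp_less) auto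
        then have d: "1 - \<delta> * S \<noteq> 0" by simp
        have "(1 - \<delta> * S) * (q * y + (1 - q) * (\<delta> * S * c + (1 - \<delta>) * (m * c)))
          = (q * (1 - \<delta> * S)) * y + ((1 - q) * (1 - \<delta> * S)) * (\<delta> * S * c) + ((1 - q) * (1 - \<delta> * S)) * (1 - \<delta>) * (m * c)"
          by algebra
        also have "\<dots> = S * (1 - \<delta>) * y + (1 - S) * (\<delta> * S * c) + (1 - \<delta>) * (m * ((1 - S) * c))"
          unfolding q' by algebra
        also have "\<dots> = (1 - \<delta> * S) * (S * c)" unfolding m_eq by algebra
        finally have fin: "q * y + (1 - q) * (\<delta> * S * c + (1 - \<delta>) * (m * c)) = S * c" using d by simp
        have mx: "max y c = c" using False by simp
        show "S * max y c \<le> q * y + (1 - q) * \<delta> * (S * max y c + m * ((\<integral>x. max (max y c) x \<partial>F) - max y c))"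
          unfolding mx mult.assoc[of "1 - q"] e fin by simp
      qed
    qed
    let ?g = "\<lambda>x. S * max y c + m * (max (max y c) x - max y c)"
    have g0: "0 \<le> ?g x" for x using m(1) S0 y by (intro add_nonneg_nonneg mult_nonneg_nonneg) auto
    have gi: "integrable F ?g" using integrable_max[OF F, of "max y c"] by (intro Bochner_Integration.integrable_add integrable_mult_right Bochner_Integration.integrable_diff) auto
    have g: "(\<integral>x. ?g x \<partial>F) = S * max y c + m * ((\<integral>x. max (max y c) x \<partial>F) - max y c)"
      using integrable_max[OF F, of "max y c"] by (simp add: prob_space)
    have "ennreal (S * max y c) \<le> ennreal (q * y + (1 - q) * \<delta> * (\<integral>x. ?g x \<partial>F))"
      unfolding g by (intro ennreal_leI fin)
    also have "\<dots> = ennreal (q * y) + ennreal ((1 - q) * \<delta>) * ennreal (\<integral>x. ?g x \<partial>F)"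
    proof -
      have "0 \<le> (\<integral>x. ?g x \<partial>F)" using g0 by simp
      then show ?thesis using q y delta by (simp add: ennreal_mult'[symmetric] ennreal_plus[symmetric] del: ennreal_plus)
    qed
    finally have le1: "ennreal (S * max y c) \<le> ennreal (q * y) + ennreal ((1 - q) * \<delta>) * ennreal (\<integral>x. ?g x \<partial>F)" .
    have "ennreal (\<integral>x. ?g x \<partial>F) = (\<integral>\<^sup>+ x. ennreal (?g x) \<partial>F)"
      by (rule nn_integral_eq_integral[symmetric]) (use gi g0 in auto)
    also have "\<dots> \<le> (\<integral>\<^sup>+ x. ennreal (rho (best (h @ [x]) / xbar) * max (best (h @ [x])) c) \<partial>F)"
      using F'(4) by (intro nn_integral_mono_AE, eventually_elim) (auto intro!: ennreal_leI m simp: best_append y y_def[symmetric])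
    finally have le2: "ennreal (\<integral>x. ?g x \<partial>F) \<le> (\<integral>\<^sup>+ x. ennreal (rho (best (h @ [x]) / xbar) * max (best (h @ [x])) c) \<partial>F)" .
    have "ennreal (S * max y c) \<le> ennreal (q * y) + ennreal ((1 - q) * \<delta>) *
      (\<integral>\<^sup>+ x. ennreal (rho (best (h @ [x]) / xbar) * max (best (h @ [x])) c) \<partial>F)"
      by (rule order_trans[OF le1]) (intro add_left_mono mult_left_mono le2, simp)
    then show "ennreal (rho (best h / xbar) * max (best h) c) \<le> ennreal (\<phi> (best h) * best h) +
      ennreal ((1 - \<phi> (best h)) * \<delta>) * (\<integral>\<^sup>+ x. ennreal (rho (best (h @ [x]) / xbar) * max (best (h @ [x])) c) \<partial>F)"
      by (simp only: S_def q_def y_def)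
  next
    show "h \<in> H" using h by (simp add: H_def)
  next
    show "0 \<le> \<delta>" "\<delta> < 1" "0 \<le> xbar" using delta xbar_nonneg by auto
  qed (fact F'(1) F'(2) \<phi>m)+
  moreover have b: "0 < best h" using h pos best_pos[of h] by (simp add: H_def)
  moreover have "1/2 \<le> rho (best h / xbar)" by (intro rho_pos(1) order_trans[OF _ h(2)]) simp
  then have "0 \<le> rho (best h / xbar) * max (best h) c" using c(1) by simp
  ultimately show ?thesis
    unfolding p c_def[symmetric] using F
    by (intro payoff_env_geI[OF F decision_rule_pstar[unfolded p] h(1) less_imp_le[OF b]])
qed

lemma historiesD:
  assumes "h \<in> histories X x0" "0 < x0" "x0 \<le> xbar"
  shows "h \<noteq> []" "x0 \<le> best h" "best h \<le> xbar"
proof -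
  show h: "h \<noteq> []" using assms by (simp add: histories_def)
  then have "set h = insert x0 (set (tl h))" using assms by (cases h) (auto simp: histories_def)
  then show "x0 \<le> best h" "best h \<le> xbar"
    using assms X_bounds by (auto simp: best_def histories_def)
qed

subsection \<open>Bounds on the performance ratio\<close>

lemma posterior:
  assumes "\<mu> \<in> priors {F \<in> environments X. consistent_env F h}"
  shows "finite (set_pmf \<mu>)" "\<And>F. F \<in> set_pmf \<mu> \<Longrightarrow> F \<in> environments X"
    "\<And>F. F \<in> set_pmf \<mu> \<Longrightarrow> 0 \<le> posterior \<mu> h F" "(\<Sum>F\<in>set_pmf \<mu>. posterior \<mu> h F) = 1"
proof -
  show fin: "finite (set_pmf \<mu>)" and "\<And>F. F \<in> set_pmf \<mu> \<Longrightarrow> F \<in> environments X"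
    using assms by (auto simp: priors_def)
  have pos: "0 < pmf \<mu> F * likelihood F h" if "F \<in> set_pmf \<mu>" for F
    using assms that by (auto simp: priors_def consistent_env_def pmf_positive)
  have "0 < (\<Sum>G\<in>set_pmf \<mu>. pmf \<mu> G * likelihood G h)"
    using fin pos by (intro sum_pos) (auto simp: set_pmf_not_empty)
  then show "(\<Sum>F\<in>set_pmf \<mu>. posterior \<mu> h F) = 1"
    and "\<And>F. F \<in> set_pmf \<mu> \<Longrightarrow> 0 \<le> posterior \<mu> h F"
    using pos by (auto simp: posterior_def sum_divide_distrib[symmetric] intro!: divide_nonneg_pos less_imp_le)
qed

section \<open>Payoff and value under a fixed prior\<close>

context
  fixes h \<mu>
  assumes h: "h \<noteq> []" "0 \<le> best h" and \<mu>: "\<mu> \<in> priors {F \<in> environments X. consistent_env F h}"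
begin

lemma payoff_prior_upper:
  assumes "decision_rule p"
  shows "payoff_prior \<delta> p \<mu> h \<le> (\<Sum>F\<in>set_pmf \<mu>. posterior \<mu> h F * max (best h) (reservation F))"
  unfolding payoff_prior_def using posterior[OF \<mu>] assms h
  by (intro sum_mono mult_left_mono payoff_env_upper) auto

lemma value_prior_upper:
  "value_prior \<delta> \<mu> h \<le> (\<Sum>F\<in>set_pmf \<mu>. posterior \<mu> h F * max (best h) (reservation F))"
  unfolding value_prior_def using decision_rule_stop by (intro cSUP_least payoff_prior_upper) auto

lemma payoff_prior_le_value:
  assumes "decision_rule p"
  shows "payoff_prior \<delta> p \<mu> h \<le> value_prior \<delta> \<mu> h"
  unfolding value_prior_def using assms payoff_prior_upper by (intro cSUP_upper bdd_aboveI2) auto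

text \<open>Stopping at once earns \<open>best h\<close> in every environment. This keeps the
  denominator of the performance ratio positive whenever \<open>best h\<close> is.\<close>

lemma best_le_value: "best h \<le> value_prior \<delta> \<mu> h"
proof -
  have "best h = (\<Sum>F\<in>set_pmf \<mu>. posterior \<mu> h F * best h)"
    by (simp add: sum_distrib_right[symmetric] posterior[OF \<mu>])
  also have "\<dots> \<le> payoff_prior \<delta> (\<lambda>_. 1) \<mu> h"
    unfolding payoff_prior_def using posterior[OF \<mu>] h by (intro sum_mono mult_left_mono payoff_env_stop) auto
  also have "\<dots> \<le> value_prior \<delta> \<mu> h" by (rule payoff_prior_le_value[OF decision_rule_stop])
  finally show ?thesis .
qed

lemma payoff_prior_nonneg: "0 \<le> payoff_prior \<delta> p \<mu> h"
  unfolding payoff_prior_def payoff_env_def using posterior[OF \<mu>] by (intro sum_nonneg mult_nonneg_nonneg) auto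

lemma payoff_ratio_nonneg: "0 \<le> payoff_prior \<delta> p \<mu> h / value_prior \<delta> \<mu> h"
  using payoff_prior_nonneg best_le_value h by simp

text \<open>The factor \<open>rho (best h / xbar)\<close> is the same for all environments, so the
  bound survives averaging with the posterior. The value under the prior is at most the average of
  the bounds for the single environments.\<close>

lemma payoff_ratio_pstar:
  assumes pos: "0 < xbar" and y: "1/6 \<le> best h / xbar" "best h \<le> xbar" "0 < best h"
  shows "rho (best h / xbar) \<le> payoff_prior \<delta> (pstar \<delta> xbar) \<mu> h / value_prior \<delta> \<mu> h"
proof -
  let ?r = "rho (best h / xbar)"
  have "0 \<le> ?r" using rho_pos(1)[of "best h / xbar"] pos y by simp
  then have "?r * value_prior \<delta> \<mu> h \<le> ?r * (\<Sum>F\<in>set_pmf \<mu>. posterior \<mu> h F * max (best h) (reservation F))"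
    by (intro mult_left_mono value_prior_upper)
  also have "\<dots> = (\<Sum>F\<in>set_pmf \<mu>. posterior \<mu> h F * (?r * max (best h) (reservation F)))"
    by (simp add: sum_distrib_left mult.left_commute)
  also have "\<dots> \<le> payoff_prior \<delta> (pstar \<delta> xbar) \<mu> h"
    unfolding payoff_prior_def using posterior[OF \<mu>] h pos y
    by (intro sum_mono mult_left_mono payoff_env_pstar_lower) auto
  finally show ?thesis using best_le_value y by (simp add: pos_le_divide_eq)
qed

end

section \<open>The infimum over histories and priors\<close>

lemma payoff_prior_return:
  "likelihood F h > 0 \<Longrightarrow> payoff_prior \<delta> p (return_pmf F) h = payoff_env \<delta> p F h"
  by (simp add: payoff_prior_def posterior_def)

lemma point_prior:
  "F \<in> environments X \<Longrightarrow> consistent_env F h \<Longrightarrow> return_pmf F \<in> priors {F \<in> environments X. consistent_env F h}"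
  by (simp add: priors_def)

text \<open>Shows that the infimum in \<open>perf_ratio\<close> is over a nonempty set. With
  \<open>\<sigma> = 0\<close> the environment is the point mass at 0, so 1 need not lie in
  \<open>X\<close>.\<close>

lemma point_mass_prior:
  assumes "0 < x0"
  shows "([x0], return_pmf (two_point 0 1)) \<in>
    {(h, \<mu>). h \<in> histories X x0 \<and> \<mu> \<in> priors {F \<in> environments X. consistent_env F h}}"
proof -
  have "two_point 0 1 \<in> environments X"
    using X_borel X_zero by (intro two_point_environment) auto
  then show ?thesis using consistent_zeros[of 0 1 x0 0] by (auto simp: histories_def priors_def)
qed

text \<open>The third claim uses the degenerate prior on \<open>F\<close>: any competing rule
  \<open>p'\<close> bounds the value from below, so the optimal rule need not be known.\<close>

lemma perf_ratio_bounds: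
  assumes x0: "0 < x0" "x0 \<le> xbar" and p: "decision_rule p"
  shows "0 \<le> perf_ratio \<delta> X (environments X) p x0" "perf_ratio \<delta> X (environments X) p x0 \<le> 1"
    and "\<And>F h p' v. \<lbrakk>h \<in> histories X x0; F \<in> environments X; consistent_env F h; decision_rule p';
      v \<le> payoff_env \<delta> p' F h\<rbrakk> \<Longrightarrow> perf_ratio \<delta> X (environments X) p x0 * v \<le> payoff_env \<delta> p F h"
proof -
  let ?S = "{(h, \<mu>). h \<in> histories X x0 \<and> \<mu> \<in> priors {F \<in> environments X. consistent_env F h}}"
  let ?f = "\<lambda>hm. payoff_prior \<delta> p (snd hm) (fst hm) / value_prior \<delta> (snd hm) (fst hm)"
  have pr: "perf_ratio \<delta> X (environments X) p x0 = (INF hm\<in>?S. ?f hm)" by (simp add: perf_ratio_def)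
  have hist: "h \<noteq> []" "0 \<le> best h" if "h \<in> histories X x0" for h
    using historiesD[OF that x0] x0 by auto
  have nonneg: "0 \<le> ?f hm" if "hm \<in> ?S" for hm
    using that hist by (auto intro!: payoff_ratio_nonneg)
  have el: "([x0], return_pmf (two_point 0 1)) \<in> ?S" using x0(1) by (rule point_mass_prior)
  then show ge0: "0 \<le> perf_ratio \<delta> X (environments X) p x0"
    unfolding pr by (intro cINF_greatest nonneg) auto
  have bdd: "bdd_below (?f ` ?S)" using nonneg by (intro bdd_belowI2)
  have le: "perf_ratio \<delta> X (environments X) p x0 \<le> payoff_prior \<delta> p \<mu> h / value_prior \<delta> \<mu> h"
    if "(h, \<mu>) \<in> ?S" for h \<mu>
    unfolding pr using cINF_lower[OF bdd that] by simp
  have "payoff_prior \<delta> p (return_pmf (two_point 0 1)) [x0] / value_prior \<delta> (return_pmf (two_point 0 1)) [x0] \<le> 1"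
    using el x0 payoff_prior_le_value[of "[x0]" "return_pmf (two_point 0 1)" p] best_le_value[of "[x0]" "return_pmf (two_point 0 1)"] p
    by (simp add: best_def divide_le_eq_1)
  then show "perf_ratio \<delta> X (environments X) p x0 \<le> 1" using le[OF el] by simp
  fix F h p' v
  assume h: "h \<in> histories X x0" and F: "F \<in> environments X" "consistent_env F h"
    and p': "decision_rule p'" and v: "v \<le> payoff_env \<delta> p' F h"
  note P = point_prior[OF F] and L = F(2)[unfolded consistent_env_def]
  have "0 < best h" using historiesD[OF h x0] x0 by simp
  then have V: "0 < value_prior \<delta> (return_pmf F) h" "v \<le> value_prior \<delta> (return_pmf F) h"
    using best_le_value[OF hist[OF h] P] payoff_prior_le_value[OF hist[OF h] P p'] v
    by (auto simp: payoff_prior_return[OF L])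
  have "perf_ratio \<delta> X (environments X) p x0 * v \<le> perf_ratio \<delta> X (environments X) p x0 * value_prior \<delta> (return_pmf F) h"
    using V ge0 by (intro mult_left_mono)
  also have "\<dots> \<le> payoff_env \<delta> p F h"
    using le[of h "return_pmf F"] h P V by (simp add: pos_le_divide_eq payoff_prior_return[OF L])
  finally show "perf_ratio \<delta> X (environments X) p x0 * v \<le> payoff_env \<delta> p F h" .
qed

text \<open>The best alternative never falls below \<open>x0\<close> and \<open>rho\<close> is
  increasing, so the bound is weakest where \<open>best h = x0\<close>.\<close>

lemma perf_ratio_pstar_ge:
  assumes x0: "0 < x0" "x0 \<le> xbar" "1/6 \<le> x0 / xbar"
  shows "rho (x0 / xbar) \<le> perf_ratio \<delta> X (environments X) (pstar \<delta> xbar) x0"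
  unfolding perf_ratio_def
proof (rule cINF_greatest)
  show "{(h, \<mu>). h \<in> histories X x0 \<and> \<mu> \<in> priors {F \<in> environments X. consistent_env F h}} \<noteq> {}"
    using point_mass_prior[OF x0(1)] by blast
next
  fix hm assume "hm \<in> {(h, \<mu>). h \<in> histories X x0 \<and> \<mu> \<in> priors {F \<in> environments X. consistent_env F h}}"
  then obtain h \<mu> where hm: "hm = (h, \<mu>)" "h \<in> histories X x0" "\<mu> \<in> priors {F \<in> environments X. consistent_env F h}"
    by auto
  note b = historiesD[OF hm(2) x0(1,2)]
  have q: "x0 / xbar \<le> best h / xbar" using b x0 by (intro divide_right_mono) auto
  have "rho (x0 / xbar) \<le> rho (best h / xbar)" using q x0 by (intro rho_mono) auto
  also have "\<dots> \<le> payoff_prior \<delta> (pstar \<delta> xbar) \<mu> h / value_prior \<delta> \<mu> h"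
    using b q x0 hm by (intro payoff_ratio_pstar) auto
  finally show "rho (x0 / xbar) \<le> payoff_prior \<delta> (pstar \<delta> xbar) (snd hm) (fst hm) / value_prior \<delta> (snd hm) (fst hm)"
    by (simp add: hm)
qed

text \<open>With \<open>\<sigma> = 0\<close> the environment is the point mass at 0 and the bound reads \<open>y * D t\<close>.\<close>

lemma two_point_payoff_upper:
  fixes D :: "nat \<Rightarrow> real"
  assumes p: "decision_rule p" and \<sigma>: "0 \<le> \<sigma>" "\<sigma> \<le> 1" and y: "0 \<le> y" "y < x"
    and c: "c * (1 - \<beta>) = \<delta> * \<sigma> * x" "\<beta> = \<delta> * (1 - \<sigma>)" "0 \<le> c"
    and D: "\<And>t. D t = p (y # replicate t 0) + (1 - p (y # replicate t 0)) * \<beta> * D (Suc t)"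
      "\<And>t. 0 \<le> D t" "\<And>t. D t \<le> 1"
  shows "payoff_env \<delta> p (two_point \<sigma> x) (y # replicate t 0) \<le> c - (c - y) * D t"
proof -
  \<comment> \<open>A mixture of \<open>c\<close> and \<open>y\<close> with weight
    \<open>D t\<close> on \<open>y\<close>. The factor \<open>\<beta>\<close> combines discounting
    with the chance that the next alternative is again 0.\<close>
  define w where "w = (\<lambda>t. c - (c - y) * D t)"
  have w0: "0 \<le> w t" for t
  proof -
    have "w t = c * (1 - D t) + y * D t" by (simp add: w_def algebra_simps)
    then show ?thesis using D(2,3)[of t] c y by simp
  qed
  \<comment> \<open>Once \<open>x\<close> has occurred the payoff is at most \<open>x\<close>.
    Before that the history is \<open>y\<close> followed by zeros, and \<open>length h - 1\<close>
    counts the zeros.\<close>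
  define W where "W = (\<lambda>h. if best h = x then ennreal x else ennreal (w (length h - 1)))"
  define H where "H = {h. h \<noteq> [] \<and> best h = x} \<union> range (\<lambda>t. y # replicate t 0)"
  let ?F = "two_point \<sigma> x"
  have x0: "0 < x" using y by simp
  have byz: "best (y # replicate t 0) = y" for t using y by (simp add: best_zeros)
  have nz: "(\<integral>\<^sup>+ z. W (h @ [z]) \<partial>?F) = W (h @ [x]) * ennreal \<sigma> + W (h @ [0]) * ennreal (1 - \<sigma>)" for h
    by (rule nn_integral_two_point[OF \<sigma>])
  have "(\<Sum>k. stop_payoff \<delta> p ?F (y # replicate t 0) k) \<le> W (y # replicate t 0)"
  proof (rule payoff_supersolution[where H=H])
    fix h assume "h \<in> H"
    then consider "h \<noteq> []" "best h = x" | s where "h = y # replicate s 0" by (auto simp: H_def)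
    then show "AE z in ?F. h @ [z] \<in> H"
    proof cases
      case 1
      show ?thesis using AE_two_point by eventually_elim (use 1 x0 in \<open>auto simp: H_def best_append\<close>)
    next
      case (2 s)
      have "h @ [0] \<in> H" unfolding 2 zeros_append H_def by (rule UnI2) (rule rangeI)
      moreover have "h @ [x] \<in> H" using best_append[of h x] byz[of s] y by (simp add: H_def 2)
      ultimately show ?thesis using AE_two_point[where \<sigma>=\<sigma> and x=x] by (auto elim!: eventually_mono)
    qed
  next
    fix h assume "h \<in> H"
    then consider "h \<noteq> []" "best h = x" | s where "h = y # replicate s 0" by (auto simp: H_def)
    then show "ennreal (p h * best h) + ennreal ((1 - p h) * \<delta>) * (\<integral>\<^sup>+ z. W (h @ [z]) \<partial>?F) \<le> W h"
    proof cases
      case 1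
      have ph: "0 \<le> p h" "p h \<le> 1" using p by (auto simp: decision_rule_def)
      have "W (h @ [x]) = ennreal x" "W (h @ [0]) = ennreal x" using 1 x0 by (auto simp: W_def best_append)
      then have "(\<integral>\<^sup>+ z. W (h @ [z]) \<partial>?F) = ennreal (x * \<sigma> + x * (1 - \<sigma>))"
        unfolding nz using \<sigma> x0 by (simp add: ennreal_mult'[symmetric] ennreal_plus[symmetric] del: ennreal_plus)
      also have "x * \<sigma> + x * (1 - \<sigma>) = x" by (simp add: algebra_simps)
      finally have "ennreal (p h * best h) + ennreal ((1 - p h) * \<delta>) * (\<integral>\<^sup>+ z. W (h @ [z]) \<partial>?F)
        = ennreal (p h * x + (1 - p h) * \<delta> * x)"
        using 1 ph x0 delta by (simp add: ennreal_mult'[symmetric] ennreal_plus[symmetric] del: ennreal_plus)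
      also have "\<dots> \<le> ennreal (p h * x + (1 - p h) * 1 * x)"
        using ph delta x0 by (intro ennreal_leI add_left_mono mult_right_mono mult_left_mono) auto
      also have "\<dots> = W h" using 1 by (simp add: W_def algebra_simps)
      finally show ?thesis .
    next
      case (2 s)
      have ph: "0 \<le> p h" "p h \<le> 1" using p by (auto simp: decision_rule_def)
      have "W (h @ [0]) = ennreal (w (Suc s))"
        unfolding 2 zeros_append using byz y by (simp add: W_def del: replicate_Suc)
      moreover have "W (h @ [x]) = ennreal x"
        using best_append[of h x] byz[of s] y by (simp add: W_def 2)
      ultimately have "(\<integral>\<^sup>+ z. W (h @ [z]) \<partial>?F) = ennreal (x * \<sigma> + w (Suc s) * (1 - \<sigma>))"
        unfolding nz using \<sigma> x0 w0 by (simp add: ennreal_mult'[symmetric] ennreal_plus[symmetric] del: ennreal_plus)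
      then have "ennreal (p h * best h) + ennreal ((1 - p h) * \<delta>) * (\<integral>\<^sup>+ z. W (h @ [z]) \<partial>?F)
        = ennreal (p h * y + (1 - p h) * \<delta> * (x * \<sigma> + w (Suc s) * (1 - \<sigma>)))"
        using ph y x0 delta w0[of "Suc s"] \<sigma> byz[of s]
        by (simp add: 2 ennreal_mult'[symmetric] ennreal_plus[symmetric] del: ennreal_plus)
      also have "p h * y + (1 - p h) * \<delta> * (x * \<sigma> + w (Suc s) * (1 - \<sigma>))
        = p h * y + (1 - p h) * (\<delta> * \<sigma> * x + \<beta> * w (Suc s))"
        unfolding c(2) by algebra
      also have "\<dots> = w s"
        unfolding c(1)[symmetric] w_def D(1)[of s] 2 by algebra
      finally show ?thesis using byz[of s] y by (simp add: W_def 2)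
    qed
  next
    show "y # replicate t 0 \<in> H" by (simp add: H_def)
  qed (use p delta two_point_basic in auto)
  also have "W (y # replicate t 0) = ennreal (w t)" using byz y by (simp add: W_def)
  finally have "payoff_env \<delta> p ?F (y # replicate t 0) \<le> w t"
    unfolding payoff_env_eq using w0 by (intro enn2real_leI)
  then show ?thesis by (simp add: w_def)
qed

text \<open>The witness continues until an alternative of at least \<open>x\<close> is at hand. Its
  value while waiting is \<open>c\<close>, since the hypothesis on \<open>c\<close> says
  \<open>c = \<delta> * (x * \<sigma> + c * (1 - \<sigma>))\<close>.\<close>

lemma two_point_payoff_lower:
  assumes X: "x \<in> X" and \<sigma>: "0 \<le> \<sigma>" "\<sigma> \<le> 1" and h: "h \<noteq> []" "0 \<le> best h"
    and c: "c * (1 - \<delta> * (1 - \<sigma>)) = \<delta> * \<sigma> * x" "0 \<le> c" "c \<le> x"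
  shows "\<exists>p. decision_rule p \<and> c \<le> payoff_env \<delta> p (two_point \<sigma> x) h"
proof -
  define \<phi> :: "real \<Rightarrow> real" where "\<phi> = (\<lambda>y. if x \<le> y then 1 else 0)"
  have d: "decision_rule (\<lambda>h. \<phi> (best h))" by (simp add: decision_rule_def \<phi>_def)
  define W where "W = (\<lambda>h. if x \<le> best h then ennreal x else ennreal c)"
  define H where "H = {h. h \<noteq> [] \<and> 0 \<le> best h}"
  let ?F = "two_point \<sigma> x"
  have env: "?F \<in> environments X" using X X_borel X_zero \<sigma> by (intro two_point_environment) auto
  have x0: "0 \<le> x" using X_bounds X by simp
  have "W h \<le> (\<Sum>k. stop_payoff \<delta> (\<lambda>h. \<phi> (best h)) ?F h k)"
  proof (rule payoff_subsolution[where H=H and K=x])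
    show "\<phi> \<in> borel_measurable borel" unfolding \<phi>_def by measurable
  next
    fix h assume h: "h \<in> H"
    show "h \<noteq> [] \<and> (AE z in ?F. h @ [z] \<in> H)" using h by (auto simp: H_def best_append)
    show "W h \<le> ennreal x" using c by (auto simp: W_def intro: ennreal_leI)
    show "W h \<le> ennreal (\<phi> (best h) * best h)
        + ennreal ((1 - \<phi> (best h)) * \<delta>) * (\<integral>\<^sup>+ z. W (h @ [z]) \<partial>?F)"
    proof (cases "x \<le> best h")
      case True
      then show ?thesis by (auto simp: W_def \<phi>_def intro: ennreal_leI)
    next
      case False
      have "(\<integral>\<^sup>+ z. W (h @ [z]) \<partial>?F) = ennreal x * ennreal \<sigma> + ennreal c * ennreal (1 - \<sigma>)"
        unfolding nn_integral_two_point[OF \<sigma>] using h False by (auto simp: W_def best_append H_def)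
      also have "\<dots> = ennreal (x * \<sigma> + c * (1 - \<sigma>))"
        using \<sigma> x0 c by (simp add: ennreal_mult'[symmetric] ennreal_plus[symmetric] del: ennreal_plus)
      finally have "ennreal \<delta> * (\<integral>\<^sup>+ z. W (h @ [z]) \<partial>?F) = ennreal (\<delta> * (x * \<sigma> + c * (1 - \<sigma>)))"
        using delta by (simp add: ennreal_mult')
      also have "\<delta> * (x * \<sigma> + c * (1 - \<sigma>)) = c" using c(1) by algebra
      finally show ?thesis using False by (simp add: W_def \<phi>_def)
    qed
  next
    show "h \<in> H" using h by (simp add: H_def)
  next
    show "0 \<le> \<delta>" "\<delta> < 1" "0 \<le> x" using delta x0 by auto
  qed (fact d two_point_basic)+
  moreover have "ennreal c \<le> W h" using c by (auto simp: W_def intro: ennreal_leI)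
  ultimately have "ennreal c \<le> (\<Sum>k. stop_payoff \<delta> (\<lambda>h. \<phi> (best h)) ?F h k)" by (rule order_trans[rotated])
  from payoff_env_geI[OF env d h this c(2)] d show ?thesis by blast
qed

section \<open>Upper bounds on the ratio from histories of zeros\<close>

lemma zeros_history: "x0 # replicate t 0 \<in> histories X x0"
  using X_zero by (auto simp: histories_def)

lemma perf_ratio_le_point_mass:
  fixes A :: "nat \<Rightarrow> real"
  assumes x0: "0 < x0" "x0 \<le> xbar" and p: "decision_rule p"
    and A: "\<And>t. A t = p (x0 # replicate t 0) + (1 - p (x0 # replicate t 0)) * \<delta> * A (Suc t)"
      "\<And>t. 0 \<le> A t" "\<And>t. A t \<le> 1"
  shows "perf_ratio \<delta> X (environments X) p x0 \<le> A 0"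
proof -
  \<comment> \<open>The value \<open>x0 + 1\<close> has probability 0; it only has to exceed
    \<open>x0\<close>.\<close>
  let ?F = "two_point 0 (x0 + 1)" and ?h = "x0 # replicate 0 0"
  have env: "?F \<in> environments X" using X_borel X_zero by (intro two_point_environment) auto
  have "perf_ratio \<delta> X (environments X) p x0 * x0 \<le> payoff_env \<delta> p ?F ?h"
  proof (rule perf_ratio_bounds(3)[OF x0 p zeros_history env _ decision_rule_stop])
    show "consistent_env ?F ?h" using x0 by (intro consistent_zeros) auto
    show "x0 \<le> payoff_env \<delta> (\<lambda>_. 1) ?F ?h"
      using payoff_env_stop[OF env, of "[x0]"] x0 by (simp add: best_def)
  qed
  also have "\<dots> \<le> 0 - (0 - x0) * A 0"
  proof (rule two_point_payoff_upper[where \<beta>=\<delta> and D=A, OF p])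
    show "A t = p (x0 # replicate t 0) + (1 - p (x0 # replicate t 0)) * \<delta> * A (Suc t)" for t
      by (rule A(1))
  qed (use x0 A(2,3) in auto)
  finally have "perf_ratio \<delta> X (environments X) p x0 * x0 \<le> A 0 * x0" by (simp add: mult.commute)
  then show ?thesis using x0 by simp
qed

text \<open>Zeros leave the best alternative at \<open>x0\<close>, so \<open>pstar\<close> stops
  with constant probability and the constant \<open>rho u\<close> solves the recursion of the point
  mass at 0.\<close>

lemma perf_ratio_pstar_le:
  assumes x0: "0 < x0" "x0 \<le> xbar"
  shows "perf_ratio \<delta> X (environments X) (pstar \<delta> xbar) x0 \<le> rho (x0 / xbar)"
proof -
  define u where "u = x0 / xbar"
  have u: "0 \<le> u" "u \<le> 1" using x0 by (auto simp: u_def)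
  have p: "pstar \<delta> xbar (x0 # replicate t 0) = qstar \<delta> u" for t
    using u x0 by (simp add: pstar_def best_zeros u_def)
  show ?thesis
    unfolding u_def[symmetric]
  proof (rule perf_ratio_le_point_mass[OF x0 decision_rule_pstar, of "\<lambda>_. rho u"])
    show "rho u = pstar \<delta> xbar (x0 # replicate t 0) + (1 - pstar \<delta> xbar (x0 # replicate t 0)) * \<delta> * rho u" for t
      unfolding p using delta u by (rule rho_fixed_point)
  qed (use rho_pos(1)[of u] rho_le_1[of u] u in auto)
qed

text \<open>A ratio \<open>R\<close> above \<open>rho\<close> forces a high payoff against the point
  mass at 0. By \<open>stationary_comparison\<close> the rule must then, after some number of zeros,
  stop so eagerly that it falls short of \<open>R\<close> in a suitable two-point
  environment.\<close>

lemma perf_ratio_le_rho: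
  assumes x0: "0 < x0" "x0 \<le> xbar" "x0 / xbar \<le> \<delta>\<^sup>2 / (2 - \<delta>)" and p: "decision_rule p"
  shows "perf_ratio \<delta> X (environments X) p x0 \<le> rho (x0 / xbar)"
proof (rule ccontr)
  define u where "u = x0 / xbar"
  define R where "R = perf_ratio \<delta> X (environments X) p x0"
  define \<rho> where "\<rho> = rho u"
  assume "\<not> ?thesis"
  then have R: "\<rho> < R" "R \<le> 1"
    using perf_ratio_bounds(2)[OF x0(1,2) p] by (auto simp: R_def \<rho>_def u_def)
  have xb: "0 < xbar" "x0 = u * xbar" using x0 by (auto simp: u_def)
  have "\<delta>\<^sup>2 < 1 * (2 - \<delta>)" using delta by (simp add: power2_eq_square) (smt (verit) mult_left_le)
  then have "\<delta>\<^sup>2 / (2 - \<delta>) < 1" using delta by (simp add: divide_less_eq)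
  then have "u < 1" using x0(3) unfolding u_def by (rule le_less_trans[rotated])
  then have u: "0 < u" "u < 1" using x0 by (auto simp: u_def)
  have \<rho>: "1/2 < \<rho>" "\<rho> < 1" "\<rho> * u = (2 * \<rho> - 1)\<^sup>2"
    unfolding \<rho>_def using u rho_pos(2) rho_less_1 rho_quadratic by auto

  \<comment> \<open>\<open>ks\<close> is the reservation value, relative to \<open>xbar\<close>, of the worst two-point environment; the
    corresponding probability of the high alternative is at most 1 because of the bound on \<open>x0 / xbar\<close>.\<close>
  define ks where "ks = (2 * \<rho> - 1) / \<rho>"
  have ks: "0 < ks" "ks < 1" using \<rho> by (auto simp: ks_def)
  have \<rho>ks1: "\<rho> * ks = 2 * \<rho> - 1" using \<rho> by (simp add: ks_def)
  have "\<rho> * (2 - ks) = 1" using \<rho>ks1 by algebra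
  note \<rho>ks = \<rho>ks1 this
  have "u * \<rho> = \<rho> * ks\<^sup>2 * \<rho>" using \<rho>(3) \<rho>ks(1) by algebra
  then have u_ks: "u = \<rho> * ks\<^sup>2" using \<rho> by simp
  have "u * (2 - ks) = ks\<^sup>2" using u_ks \<rho>ks(2) by algebra
  then have u_ks': "u = ks\<^sup>2 / (2 - ks)" using ks by (simp add: field_simps)
  have ks_le: "ks \<le> \<delta>"
  proof (rule ccontr)
    assume "\<not> ks \<le> \<delta>"
    then have "\<delta>\<^sup>2 / (2 - \<delta>) < ks\<^sup>2 / (2 - ks)"
      using ks delta by (intro frac_less) (auto intro: power_strict_mono)
    then show False using x0(3) u_ks' by (simp add: u_def)
  qed
  have "u = ks * (2 * \<rho> - 1)" using u_ks \<rho>ks by algebra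
  then have u_less: "u < ks" using ks \<rho> by simp

  \<comment> \<open>\<open>f k < 0\<close> is the contradiction reached at the end, in the limiting
    case \<open>x = xbar\<close>. With \<open>\<rho>\<close> in place of \<open>R\<close>,
    \<open>ks\<close> is a double root of \<open>f\<close>, so \<open>R - \<rho>\<close> splits off
    at \<open>ks\<close>.\<close>
  define f where "f = (\<lambda>k. u * R * (1 - k) - k * (2 * R - 1) + R\<^sup>2 * k\<^sup>2)"
  have "f ks = (R - \<rho>) * (u * (1 - ks) - 2 * ks + ks\<^sup>2 * (R + \<rho>))"
    unfolding f_def using \<rho>(3) \<rho>ks u_ks by algebra
  also have "\<dots> \<le> (R - \<rho>) * (u * (1 - ks) - 2 * ks + ks\<^sup>2 * (1 + \<rho>))"
    using R by (intro mult_left_mono add_left_mono) auto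
  also have "\<dots> = (R - \<rho>) * (2 * ks * (ks - 1))" using u_ks \<rho>ks by algebra
  also have "\<dots> < 0" using R ks by (simp add: mult_less_0_iff)
  finally have "f ks < 0" .
  \<comment> \<open>Moving slightly below \<open>ks\<close> preserves the strict inequality and
    gives \<open>k < \<delta>\<close>, hence \<open>\<sigma> < 1\<close>: zeros keep positive
    probability and the histories of zeros stay consistent.\<close>
  moreover have "(f \<longlongrightarrow> f ks) (at_left ks)" unfolding f_def by (intro tendsto_intros)
  ultimately have "\<forall>\<^sub>F k in at_left ks. f k < 0" by (intro order_tendstoD(2))
  moreover have "\<forall>\<^sub>F k in at_left ks. k \<in> {u<..<ks}" by (rule eventually_at_left_real[OF u_less])
  ultimately have "\<forall>\<^sub>F k in at_left ks. f k < 0 \<and> u < k \<and> k < ks" by eventually_elim auto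
  then obtain k where k: "f k < 0" "u < k" "k < ks"
    using eventually_happens[of _ "at_left ks"] by auto
  have k': "0 < k" "k < 1" "k < \<delta>" using k u ks ks_le by auto
  have Rk: "0 < R" "0 < 1 - R * k" "0 < 1 - \<delta> * R"
  proof -
    show R0: "0 < R" using R \<rho> by simp
    show "0 < 1 - R * k" using mult_right_mono[OF R(2), of k] k' by linarith
    show "0 < 1 - \<delta> * R" using mult_left_mono[OF R(2), of \<delta>] delta by linarith
  qed

  define B where "B = k * (2 * R - 1) - R\<^sup>2 * k\<^sup>2"
  have uB: "u * R * (1 - k) < B" using k(1) by (simp add: f_def B_def)
  moreover have "0 \<le> u * R * (1 - k)" using u Rk k' by simp
  ultimately have B: "0 < B" by simp
  have "x0 * R * (1 - k) = xbar * (u * R * (1 - k))" by (simp add: xb(2))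
  also have "\<dots> < xbar * B" using uB xb by (intro mult_strict_left_mono) auto
  finally have "x0 * R * (1 - k) / B < Sup X" using B by (simp add: divide_less_eq xbar[symmetric])
  moreover have "x0 / k < Sup X" using k k' xb by (simp add: divide_less_eq xbar[symmetric] mult.commute[of xbar])
  \<comment> \<open>\<open>xbar\<close> need not belong to \<open>X\<close>; the strict inequalities
    leave room for an element of \<open>X\<close> close to it.\<close>
  ultimately have "max (x0 * R * (1 - k) / B) (x0 / k) < Sup X" by simp
  then obtain x where x: "x \<in> X" "x0 * R * (1 - k) / B < x" "x0 / k < x"
    using less_cSupD[of X] X_zero by fastforce
  have xB: "x0 * R * (1 - k) < x * B" using x(2) B by (simp add: divide_less_eq)
  have xk: "x0 < k * x" using x(3) k' by (simp add: divide_less_eq mult.commute)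
  then have x_pos: "0 < x" using x0 k' by (smt (verit) zero_less_mult_pos)
  have "k * x < 1 * x" using x_pos k' by (intro mult_strict_right_mono) auto
  then have x0x: "x0 < x" "k * x \<le> x" using xk by auto

  \<comment> \<open>Chosen such that the reservation value of \<open>two_point \<sigma> x\<close> is \<open>k * x\<close>.\<close>
  define \<sigma> where "\<sigma> = k * (1 - \<delta>) / (\<delta> * (1 - k))"
  define \<beta> where "\<beta> = \<delta> * (1 - \<sigma>)"
  have \<sigma>\<delta>: "\<delta> * \<sigma> * (1 - k) = k * (1 - \<delta>)" using delta k' by (simp add: \<sigma>_def)
  have "k * (1 - \<delta>) < \<delta> * (1 - k)" using k' by (simp add: algebra_simps)
  then have \<sigma>: "0 \<le> \<sigma>" "\<sigma> < 1" using delta k' by (auto simp: \<sigma>_def)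
  have \<beta>k: "\<beta> * (1 - k) = \<delta> - k" using \<sigma>\<delta> unfolding \<beta>_def by algebra
  have \<beta>: "0 \<le> \<beta>" "\<beta> \<le> \<delta>" using \<sigma> delta by (auto simp: \<beta>_def mult_left_le)
  have "(k * x * (1 - \<beta>)) * (1 - k) = (\<delta> * \<sigma> * x) * (1 - k)" using \<beta>k \<sigma>\<delta> by algebra
  then have c: "k * x * (1 - \<beta>) = \<delta> * \<sigma> * x" using k' by simp

  define q where "q = (\<lambda>t. p (x0 # replicate t 0))"
  have q: "0 \<le> q t" "q t \<le> 1" for t using p by (auto simp: q_def decision_rule_def)
  obtain A where A: "\<And>t. A t = q t + (1 - q t) * \<delta> * A (Suc t)" "\<And>t. 0 \<le> A t" "\<And>t. A t \<le> 1"
    by (rule recursion_solution_exists[OF q less_imp_le[OF delta(1)] delta(2)]) (rule that)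
  obtain D where D: "\<And>t. D t = q t + (1 - q t) * \<beta> * D (Suc t)" "\<And>t. 0 \<le> D t" "\<And>t. D t \<le> 1"
    by (rule recursion_solution_exists[OF q \<beta>(1) le_less_trans[OF \<beta>(2) delta(2)]]) (rule that)
  have RA: "R \<le> A 0" unfolding R_def
    by (rule perf_ratio_le_point_mass[OF x0(1,2) p A[unfolded q_def]])

  \<comment> \<open>\<open>r\<close> is the constant stopping probability with normalised payoff
    \<open>R\<close> against zeros discounted by \<open>\<delta>\<close>, and \<open>d\<close> is
    the corresponding quantity for \<open>\<beta>\<close>.\<close>
  define r where "r = R * (1 - \<delta>) / (1 - \<delta> * R)"
  define d where "d = R * (1 - k) / (1 - R * k)"
  have r: "r * (1 - \<delta> * R) = R * (1 - \<delta>)" using Rk by (simp add: r_def)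
  have d: "d * (1 - R * k) = R * (1 - k)" using Rk by (simp add: d_def)
  have d01: "0 \<le> d" "d \<le> 1" using Rk k' R by (auto simp: d_def algebra_simps)
  have "\<exists>t. d \<le> D t"
  proof (rule stationary_comparison[where A=A and D=D and q=q and a=R and r=r, OF A(1,3) D(1,2) q \<beta> delta])
    show "R = r + (1 - r) * \<delta> * R" using r by algebra
    have "(r + (1 - r) * \<beta> * d - d) * ((1 - \<delta> * R) * (1 - R * k) * (1 - k)) = 0"
      using r d \<beta>k by algebra
    then show "d = r + (1 - r) * \<beta> * d" using Rk k' by simp
  qed (use R Rk RA d01 in auto)
  then obtain t where t: "d \<le> D t" ..

  let ?F = "two_point \<sigma> x" and ?h = "x0 # replicate t 0"
  have env: "?F \<in> environments X" using X_borel X_zero x \<sigma> by (intro two_point_environment) auto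
  obtain p' where p': "decision_rule p'" "k * x \<le> payoff_env \<delta> p' ?F ?h"
    using two_point_payoff_lower[OF x(1), of \<sigma> ?h "k * x"] \<sigma> c k' x_pos x0x x0 unfolding \<beta>_def
    by (auto simp: best_zeros)
  have "R * (k * x) \<le> payoff_env \<delta> p ?F ?h" unfolding R_def
    using perf_ratio_bounds(3)[OF x0(1,2) p zeros_history env _ p'] consistent_zeros[of \<sigma> x x0 t] \<sigma> x_pos by simp
  also have "\<dots> \<le> k * x - (k * x - x0) * D t"
    by (rule two_point_payoff_upper[OF p _ _ _ x0x(1) c \<beta>_def _ D[unfolded q_def]])
      (use \<sigma> x0 k' x_pos in auto)
  also have "\<dots> \<le> k * x - (k * x - x0) * d" using t xk by simp
  finally have "0 \<le> (k * x - (k * x - x0) * d - R * (k * x)) * (1 - R * k)" using Rk by simp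
  also have "\<dots> = x0 * R * (1 - k) - x * B" using d unfolding B_def by algebra
  finally show False using xB by simp
qed

end

theorem theorem2:
  fixes \<delta> xbar :: real and X :: "real set"
  assumes "0 < \<delta>" and "\<delta> < 1"
    and "X \<in> sets borel" and "X \<subseteq> {0..}" and "0 \<in> X"
    and "bdd_above X" and "xbar = Sup X"
  shows "(\<exists>L. 0 < L \<and> L < 1 \<and>
            (\<forall>x0. 0 < x0 \<and> x0 \<le> xbar \<and> L \<le> x0 / xbar \<longrightarrow>
               rho (x0 / xbar) \<le> R_star \<delta> X (environments X) x0 \<and> rho (x0 / xbar) > 1/2))
       \<and> (\<forall>x0. 0 < x0 \<and> x0 \<le> xbar \<and> 1/6 \<le> x0 / xbar \<longrightarrow>
            decision_rule (pstar \<delta> xbar) \<and> stationary (pstar \<delta> xbar)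
            \<and> perf_ratio \<delta> X (environments X) (pstar \<delta> xbar) x0 = rho (x0 / xbar)
            \<and> rho (x0 / xbar) > 1/2
            \<and> (x0 / xbar \<le> \<delta>\<^sup>2 / (2 - \<delta>) \<longrightarrow>
                 dynamically_robust \<delta> X (environments X) (pstar \<delta> xbar) x0))"
proof -
  interpret search \<delta> xbar X using assms by unfold_locales auto
  have eq: "perf_ratio \<delta> X (environments X) (pstar \<delta> xbar) x0 = rho (x0 / xbar)"
    and le: "rho (x0 / xbar) \<le> R_star \<delta> X (environments X) x0"
    and half: "rho (x0 / xbar) > 1/2"
    if x0: "0 < x0" "x0 \<le> xbar" "1/6 \<le> x0 / xbar" for x0
  proof -
    show eq: "perf_ratio \<delta> X (environments X) (pstar \<delta> xbar) x0 = rho (x0 / xbar)"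
      using perf_ratio_pstar_ge[OF x0] perf_ratio_pstar_le[OF x0(1,2)] by simp
    show "rho (x0 / xbar) \<le> R_star \<delta> X (environments X) x0"
      unfolding R_star_def eq[symmetric] using perf_ratio_bounds(2)[OF x0(1,2)] decision_rule_pstar
      by (intro cSUP_upper bdd_aboveI2) auto
    show "rho (x0 / xbar) > 1/2" using x0 by (intro rho_pos(2)) auto
  qed
  have robust: "dynamically_robust \<delta> X (environments X) (pstar \<delta> xbar) x0"
    if x0: "0 < x0" "x0 \<le> xbar" "1/6 \<le> x0 / xbar" and u: "x0 / xbar \<le> \<delta>\<^sup>2 / (2 - \<delta>)" for x0
  proof -
    have "R_star \<delta> X (environments X) x0 \<le> rho (x0 / xbar)"
      unfolding R_star_def using perf_ratio_le_rho[OF x0(1,2) u] decision_rule_pstar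
      by (intro cSUP_least) auto
    then show ?thesis using eq[OF x0] le[OF x0] by (simp add: dynamically_robust_def)
  qed
  have "stationary (pstar \<delta> xbar)" by (simp add: stationary_def pstar_def)
  \<comment> \<open>The threshold 1/6 of the second claim also serves as \<open>L\<close>.\<close>
  then show ?thesis
    using eq le half robust decision_rule_pstar by (intro conjI exI[of _ "1/6"]) auto
qed

end
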